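(* Let $G$ be an ample Hausdorff groupoid, let $R$ be a unital commutative ring, let $\Gamma$ be a discrete group with identity $\epsilon$, and let $(\Sigma,G,\Gamma)$ be a graded discrete $R$-twist. If $Q$ is a $\Gamma$-graded ring and $\pi: A_R(G;\Sigma) \to Q$ is a graded ring homomorphism, then $\pi$ is injective if and only if $\pi(\iota_\epsilon(\iota(f))) \neq 0$ for every nonzero $f \in A_R(\mathrm{Iso}(G_\epsilon)^\circ;\mathrm{Iso}(\Sigma_\epsilon)^\circ)$, where $\iota_\epsilon:A_R(G_\epsilon;\Sigma_\epsilon) \to A_R(G;\Sigma)$ and $\iota: A_R(\mathrm{Iso}(G_\epsilon)^\circ;\mathrm{Iso}(\Sigma_\epsilon)^\circ) \to A_R(G_\epsilon;\Sigma_\epsilon)$ are the natural inclusions.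
   Context: A topological groupoid $G$ (range $r(\alpha)=\alpha\alpha^{-1}$, source $s(\alpha)=\alpha^{-1}\alpha$, unit space $G^{(0)}=r(G)=s(G)$) is étale if $s$ (equivalently $r$) is a local homeomorphism. An open subset $U\subseteq G$ is an open bisection if $r|_U$ and $s|_U$ are homeomorphisms onto open subsets of $G^{(0)}$. An étale groupoid is ample if it has a basis of compact open bisections. $\mathrm{Iso}(G)=\{\gamma\in G: r(\gamma)=s(\gamma)\}$, and $\mathrm{Iso}(G)^\circ$ is its topological interior in $G$. Discrete twist: let $R^\times$ be the group of units of $R$ with the discrete topology. A discrete twist $(\Sigma,i,q)$ by $R^\times$ (discrete $R$-twist) over an ample Hausdorff groupoid $G$ is a sequence $G^{(0)}\times R^\times \xrightarrow{i}\Sigma\xrightarrow{q} G$, where $G^{(0)}\times R^\times$ is the trivial group bundle with fibres $R^\times$, $\Sigma$ is a Hausdorff étale groupoid with $\Sigma^{(0)}=i(G^{(0)}\times\{1\})$, and $i,q$ are continuous groupoid homomorphisms restricting to homeomorphisms of unit spaces, such that: (DT1) $i(\{x\}\times R^\times)=q^{-1}(x)$ for every $x\in G^{(0)}$, $i$ is injective, $q$ is surjective; (DT2) for each $\alpha\in G$ there are an open bisection $B_\alpha\ni\alpha$ of $G$ and a continuous map $P_\alpha:B_\alpha\to\Sigma$ with $q\circ P_\alpha=\mathrm{id}_{B_\alpha}$ such that $(\beta,t)\mapsto i(r(\beta),t)P_\alpha(\beta)$ is a homeomorphism from $B_\alpha\times R^\times$ onto $q^{-1}(B_\alpha)$; (DT3)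 $i(r(\sigma),t)\sigma=\sigma\, i(s(\sigma),t)$ for all $\sigma\in\Sigma$, $t\in R^\times$ (identifying $\Sigma^{(0)}$ with $G^{(0)}$ via $q$). $R^\times$ acts on $\Sigma$ by $t\cdot\sigma=i(r(\sigma),t)\sigma$. Twisted Steinberg algebra: $A_R(G;\Sigma)$ is the $R$-module of locally constant functions $f:\Sigma\to R$ that are $R^\times$-contravariant, i.e. $f(t\cdot\sigma)=t^{-1}f(\sigma)$, and for which $\mathrm{supp}_G(f):=q(\mathrm{supp}(f))$ is compact, where $\mathrm{supp}(f)=\{\sigma: f(\sigma)\neq0\}$. Its product is $(f*g)(\sigma)=\sum_{\alpha} f(S(\alpha))\,g(S(\alpha)^{-1}\sigma)$, the sum over $\alpha\in \mathrm{supp}_G(f)$ with $r(\alpha)=r(q(\sigma))$, where $S:G\to\Sigma$ is any (not necessarily continuous) section of $q$; the product is independent of $S$. Gradings: a graded discrete $R$-twist $(\Sigma,G,\Gamma)$ is a discrete twist $(\Sigma,i,q)$ by $R^\times$ over $G$ together with continuous groupoid homomorphisms $c_\Sigma:\Sigma\to\Gamma$ and $c_G:G\to\Gamma$ with $c_\Sigma=c_G\circ q$. Put $G_\gamma=c_G^{-1}(\gamma)$, $\Sigma_\gamma=c_\Sigma^{-1}(\gamma)$ (clopen sets; $G_\epsilon$ is a clopen subgroupoid and $\Sigma_\epsilon=q^{-1}(G_\epsilon)$). Then $A_R(G;\Sigma)$ is $\Gamma$-graded with homogeneous components $A_R(G;\Sigma)_\gamma=\{f: \mathrm{supp}_G(f)\subseteq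 G_\gamma\}$. A graded ring homomorphism is a ring homomorphism (not necessarily unital) mapping the degree-$\gamma$ component into the degree-$\gamma$ component for each $\gamma\in\Gamma$. Subtwists: for an open subgroupoid $H\subseteq G$, restricting $i,q$ gives a discrete twist $H^{(0)}\times R^\times\to q^{-1}(H)\to H$, and $A_R(H;q^{-1}(H))$ is a subalgebra of $A_R(G;\Sigma)$ by extending functions by zero. This applies to $H=G_\epsilon$ with $q^{-1}(H)=\Sigma_\epsilon$, and (inside $G_\epsilon$) to $H=\mathrm{Iso}(G_\epsilon)^\circ$ with $q^{-1}(H)=\mathrm{Iso}(\Sigma_\epsilon)^\circ$. *)

theory Defs
  imports "HOL-Analysis.Analysis"
begin

section \<open>Topological groupoids\<close>

text \<open>The set of arrows is the \<^const>\<open>topspace\<close> of the topology; \<open>composable\<close> is the set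
  $G^{(2)}$. Multiplication and inversion are only meaningful on these sets.\<close>

record 'a tgroupoid =
  gtop :: "'a topology"
  composable :: "('a \<times> 'a) set"
  gmult :: "'a \<Rightarrow> 'a \<Rightarrow> 'a"
  ginv :: "'a \<Rightarrow> 'a"

definition arrows :: "'a tgroupoid \<Rightarrow> 'a set" where
  "arrows G = topspace (gtop G)"

definition rng :: "'a tgroupoid \<Rightarrow> 'a \<Rightarrow> 'a" where
  "rng G \<alpha> = gmult G \<alpha> (ginv G \<alpha>)"

definition src :: "'a tgroupoid \<Rightarrow> 'a \<Rightarrow> 'a" where
  "src G \<alpha> = gmult G (ginv G \<alpha>) \<alpha>"

definition unit_space :: "'a tgroupoid \<Rightarrow> 'a set" where
  "unit_space G = rng G ` arrows G"

definition unit_top :: "'a tgroupoid \<Rightarrow> 'a topology" where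
  "unit_top G = subtopology (gtop G) (unit_space G)"

text \<open>The algebraic axioms are those of Hahn and Renault; they imply that $(\alpha,\beta)$ is
  composable exactly when $s(\alpha) = r(\beta)$.\<close>

locale topological_groupoid =
  fixes G :: "'a tgroupoid"
  assumes composable_subset: "composable G \<subseteq> arrows G \<times> arrows G"
    and gmult_closed: "(\<alpha>, \<beta>) \<in> composable G \<Longrightarrow> gmult G \<alpha> \<beta> \<in> arrows G"
    and ginv_closed: "\<alpha> \<in> arrows G \<Longrightarrow> ginv G \<alpha> \<in> arrows G"
    and ginv_ginv: "\<alpha> \<in> arrows G \<Longrightarrow> ginv G (ginv G \<alpha>) = \<alpha>"
    and composable_assoc: "(\<alpha>, \<beta>) \<in> composable G \<Longrightarrow> (\<beta>, \<gamma>) \<in> composable G \<Longrightarrow>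
      (gmult G \<alpha> \<beta>, \<gamma>) \<in> composable G \<and> (\<alpha>, gmult G \<beta> \<gamma>) \<in> composable G \<and>
      gmult G (gmult G \<alpha> \<beta>) \<gamma> = gmult G \<alpha> (gmult G \<beta> \<gamma>)"
    and composable_ginv: "\<alpha> \<in> arrows G \<Longrightarrow> (\<alpha>, ginv G \<alpha>) \<in> composable G"
    and cancel_left: "(\<alpha>, \<beta>) \<in> composable G \<Longrightarrow> gmult G (ginv G \<alpha>) (gmult G \<alpha> \<beta>) = \<beta>"
    and cancel_right: "(\<alpha>, \<beta>) \<in> composable G \<Longrightarrow> gmult G (gmult G \<alpha> \<beta>) (ginv G \<beta>) = \<alpha>"
    and continuous_gmult: "continuous_map
      (subtopology (prod_topology (gtop G) (gtop G)) (composable G)) (gtop G)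
      (\<lambda>(\<alpha>, \<beta>). gmult G \<alpha> \<beta>)"
    and continuous_ginv: "continuous_map (gtop G) (gtop G) (ginv G)"

definition local_homeomorphism :: "'a topology \<Rightarrow> 'b topology \<Rightarrow> ('a \<Rightarrow> 'b) \<Rightarrow> bool" where
  "local_homeomorphism X Y f \<longleftrightarrow> f \<in> topspace X \<rightarrow> topspace Y \<and>
     (\<forall>x \<in> topspace X. \<exists>U. openin X U \<and> x \<in> U \<and> openin Y (f ` U) \<and>
        homeomorphic_map (subtopology X U) (subtopology Y (f ` U)) f)"

locale etale_groupoid = topological_groupoid +
  assumes local_homeomorphism_src: "local_homeomorphism (gtop G) (unit_top G) (src G)"

definition open_bisection :: "'a tgroupoid \<Rightarrow> 'a set \<Rightarrow> bool" where
  "open_bisection G U \<longleftrightarrow> openin (gtop G) U \<and>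
     openin (unit_top G) (rng G ` U) \<and> openin (unit_top G) (src G ` U) \<and>
     homeomorphic_map (subtopology (gtop G) U) (subtopology (unit_top G) (rng G ` U)) (rng G) \<and>
     homeomorphic_map (subtopology (gtop G) U) (subtopology (unit_top G) (src G ` U)) (src G)"

locale ample_groupoid = etale_groupoid +
  assumes basis_compact_open_bisections: "openin (gtop G) U \<Longrightarrow> \<alpha> \<in> U \<Longrightarrow>
    \<exists>B. compactin (gtop G) B \<and> open_bisection G B \<and> \<alpha> \<in> B \<and> B \<subseteq> U"

definition continuous_groupoid_hom ::
    "'a tgroupoid \<Rightarrow> 'b tgroupoid \<Rightarrow> ('a \<Rightarrow> 'b) \<Rightarrow> bool" where
  "continuous_groupoid_hom G H \<phi> \<longleftrightarrow> continuous_map (gtop G) (gtop H) \<phi> \<and>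
     (\<forall>(\<alpha>, \<beta>) \<in> composable G. (\<phi> \<alpha>, \<phi> \<beta>) \<in> composable H \<and>
        \<phi> (gmult G \<alpha> \<beta>) = gmult H (\<phi> \<alpha>) (\<phi> \<beta>))"

definition restrict_groupoid :: "'a tgroupoid \<Rightarrow> 'a set \<Rightarrow> 'a tgroupoid" where
  "restrict_groupoid G H = G\<lparr>gtop := subtopology (gtop G) H,
     composable := composable G \<inter> H \<times> H\<rparr>"

definition Iso :: "'a tgroupoid \<Rightarrow> 'a set" where
  "Iso G = {\<gamma> \<in> arrows G. rng G \<gamma> = src G \<gamma>}"

definition Iso_interior :: "'a tgroupoid \<Rightarrow> 'a tgroupoid" where
  "Iso_interior G = restrict_groupoid G (gtop G interior_of Iso G)"

section \<open>Discrete twists\<close>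

text \<open>The sort \<open>{comm_ring, monoid_mult}\<close> describes unital commutative rings; unlike
  \<^class>\<open>comm_ring_1\<close> it does not exclude the zero ring.\<close>

definition ring_units :: "'r::{comm_ring, monoid_mult} set" where
  "ring_units = {t. \<exists>u. t * u = 1}"

definition unit_inverse :: "'r::{comm_ring, monoid_mult} \<Rightarrow> 'r" where
  "unit_inverse t = (THE u. t * u = 1)"

definition trivial_bundle ::
    "'a tgroupoid \<Rightarrow> ('a \<times> 'r::{comm_ring, monoid_mult}) tgroupoid" where
  "trivial_bundle G = \<lparr>
     gtop = prod_topology (unit_top G) (discrete_topology ring_units),
     composable = {((x, t), (y, u)) | x y t u.
       x \<in> unit_space G \<and> y = x \<and> t \<in> ring_units \<and> u \<in> ring_units},
     gmult = (\<lambda>(x, t) (y, u). (x, t * u)),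
     ginv = (\<lambda>(x, t). (x, unit_inverse t))\<rparr>"

text \<open>In the centrality axiom \<open>DT3\<close>, and in the action below, $\Sigma^{(0)}$ is identified with $G^{(0)}$ via $q$.\<close>

locale discrete_twist = G: ample_groupoid G + \<Sigma>: etale_groupoid \<Sigma>
  for G :: "'a tgroupoid" and \<Sigma> :: "'b tgroupoid" +
  fixes i :: "'a \<times> 'r::{comm_ring, monoid_mult} \<Rightarrow> 'b" and q :: "'b \<Rightarrow> 'a"
  assumes Hausdorff_G: "Hausdorff_space (gtop G)"
    and Hausdorff_\<Sigma>: "Hausdorff_space (gtop \<Sigma>)"
    and unit_space_\<Sigma>: "unit_space \<Sigma> = i ` (unit_space G \<times> {1})"
    and hom_i: "continuous_groupoid_hom (trivial_bundle G) \<Sigma> i"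
    and hom_q: "continuous_groupoid_hom \<Sigma> G q"
    and homeo_i: "homeomorphic_map (unit_top (trivial_bundle G :: ('a \<times> 'r) tgroupoid))
      (unit_top \<Sigma>) i"
    and homeo_q: "homeomorphic_map (unit_top \<Sigma>) (unit_top G) q"
    and DT1_exact: "x \<in> unit_space G \<Longrightarrow> i ` ({x} \<times> ring_units) = {\<sigma> \<in> arrows \<Sigma>. q \<sigma> = x}"
    and DT1_inj: "inj_on i (unit_space G \<times> ring_units)"
    and DT1_surj: "q ` arrows \<Sigma> = arrows G"
    and DT2: "\<alpha> \<in> arrows G \<Longrightarrow> \<exists>B P. open_bisection G B \<and> \<alpha> \<in> B \<and>
      continuous_map (subtopology (gtop G) B) (gtop \<Sigma>) P \<and> (\<forall>\<beta>\<in>B. q (P \<beta>) = \<beta>) \<and>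
      homeomorphic_map
        (prod_topology (subtopology (gtop G) B) (discrete_topology ring_units))
        (subtopology (gtop \<Sigma>) {\<sigma> \<in> arrows \<Sigma>. q \<sigma> \<in> B})
        (\<lambda>(\<beta>, t). gmult \<Sigma> (i (rng G \<beta>, t)) (P \<beta>))"
    and DT3: "\<sigma> \<in> arrows \<Sigma> \<Longrightarrow> t \<in> ring_units \<Longrightarrow>
      gmult \<Sigma> (i (q (rng \<Sigma> \<sigma>), t)) \<sigma> = gmult \<Sigma> \<sigma> (i (q (src \<Sigma> \<sigma>), t))"

definition twist_act ::
    "'b tgroupoid \<Rightarrow> ('a \<times> 'r \<Rightarrow> 'b) \<Rightarrow> ('b \<Rightarrow> 'a) \<Rightarrow> 'r \<Rightarrow> 'b \<Rightarrow> 'b" where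
  "twist_act \<Sigma> i q t \<sigma> = gmult \<Sigma> (i (q (rng \<Sigma> \<sigma>), t)) \<sigma>"

text \<open>The discrete group \<open>\<Gamma>\<close> is the type \<open>'g\<close>; it need not be abelian although
  \<^class>\<open>group_add\<close> is written additively, so the identity $\epsilon$ is \<open>0\<close>.\<close>

definition group_groupoid :: "'g::group_add tgroupoid" where
  "group_groupoid = \<lparr>gtop = discrete_topology UNIV, composable = UNIV, gmult = (+), ginv = uminus\<rparr>"

locale graded_discrete_twist = discrete_twist G \<Sigma> i q
  for G :: "'a tgroupoid" and \<Sigma> :: "'b tgroupoid"
    and i :: "'a \<times> 'r::{comm_ring, monoid_mult} \<Rightarrow> 'b" and q :: "'b \<Rightarrow> 'a" +
  fixes c\<^sub>\<Sigma> :: "'b \<Rightarrow> 'g::group_add" and c\<^sub>G :: "'a \<Rightarrow> 'g"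
  assumes hom_c\<^sub>\<Sigma>: "continuous_groupoid_hom \<Sigma> group_groupoid c\<^sub>\<Sigma>"
    and hom_c\<^sub>G: "continuous_groupoid_hom G group_groupoid c\<^sub>G"
    and c\<^sub>\<Sigma>_eq: "\<sigma> \<in> arrows \<Sigma> \<Longrightarrow> c\<^sub>\<Sigma> \<sigma> = c\<^sub>G (q \<sigma>)"

definition degree_fibre :: "'a tgroupoid \<Rightarrow> ('a \<Rightarrow> 'g) \<Rightarrow> 'g \<Rightarrow> 'a set" where
  "degree_fibre G c \<gamma> = {\<alpha> \<in> arrows G. c \<alpha> = \<gamma>}"

definition identity_component :: "'a tgroupoid \<Rightarrow> ('a \<Rightarrow> 'g::group_add) \<Rightarrow> 'a tgroupoid" where
  "identity_component G c = restrict_groupoid G (degree_fibre G c 0)"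

section \<open>Twisted Steinberg algebras\<close>

definition supp :: "'b tgroupoid \<Rightarrow> ('b \<Rightarrow> 'r::zero) \<Rightarrow> 'b set" where
  "supp \<Sigma> f = {\<sigma> \<in> arrows \<Sigma>. f \<sigma> \<noteq> 0}"

definition supp\<^sub>G :: "'b tgroupoid \<Rightarrow> ('b \<Rightarrow> 'a) \<Rightarrow> ('b \<Rightarrow> 'r::zero) \<Rightarrow> 'a set" where
  "supp\<^sub>G \<Sigma> q f = q ` supp \<Sigma> f"

text \<open>A function on $\Sigma$ is represented by a total function on the ambient type that is zero
  outside the set of arrows of $\Sigma$.\<close>

definition twisted_steinberg :: "'a tgroupoid \<Rightarrow> 'b tgroupoid \<Rightarrow>
    ('a \<times> 'r::{comm_ring, monoid_mult} \<Rightarrow> 'b) \<Rightarrow> ('b \<Rightarrow> 'a) \<Rightarrow> ('b \<Rightarrow> 'r) set" where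
  "twisted_steinberg G \<Sigma> i q = {f.
     (\<forall>\<sigma>. \<sigma> \<notin> arrows \<Sigma> \<longrightarrow> f \<sigma> = 0) \<and>
     (\<forall>\<sigma>\<in>arrows \<Sigma>. \<exists>U. openin (gtop \<Sigma>) U \<and> \<sigma> \<in> U \<and> (\<forall>\<tau>\<in>U. f \<tau> = f \<sigma>)) \<and>
     (\<forall>t\<in>ring_units. \<forall>\<sigma>\<in>arrows \<Sigma>. f (twist_act \<Sigma> i q t \<sigma>) = unit_inverse t * f \<sigma>) \<and>
     compactin (gtop G) (supp\<^sub>G \<Sigma> q f)}"

text \<open>The section $S$ of $q$ in the convolution formula is the one chosen by \<^const>\<open>inv_into\<close>;
  for functions in the algebra the product does not depend on this choice, and the sum is
  finite.\<close>

definition twisted_conv :: "'a tgroupoid \<Rightarrow> 'b tgroupoid \<Rightarrow> ('b \<Rightarrow> 'a) \<Rightarrow>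
    ('b \<Rightarrow> 'r) \<Rightarrow> ('b \<Rightarrow> 'r) \<Rightarrow> 'b \<Rightarrow> 'r::{comm_ring, monoid_mult}" where
  "twisted_conv G \<Sigma> q f g = (\<lambda>\<sigma>. if \<sigma> \<in> arrows \<Sigma> then
     (let S = inv_into (arrows \<Sigma>) q in
      \<Sum>\<alpha> | \<alpha> \<in> supp\<^sub>G \<Sigma> q f \<and> rng G \<alpha> = rng G (q \<sigma>).
        f (S \<alpha>) * g (gmult \<Sigma> (ginv \<Sigma> (S \<alpha>)) \<sigma>))
     else 0)"

definition steinberg_component :: "'a tgroupoid \<Rightarrow> 'b tgroupoid \<Rightarrow>
    ('a \<times> 'r::{comm_ring, monoid_mult} \<Rightarrow> 'b) \<Rightarrow> ('b \<Rightarrow> 'a) \<Rightarrow> ('a \<Rightarrow> 'g) \<Rightarrow> 'g \<Rightarrow> ('b \<Rightarrow> 'r) set" where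
  "steinberg_component G \<Sigma> i q c\<^sub>G \<gamma> =
     {f \<in> twisted_steinberg G \<Sigma> i q. supp\<^sub>G \<Sigma> q f \<subseteq> degree_fibre G c\<^sub>G \<gamma>}"

definition extend_by_zero :: "'b tgroupoid \<Rightarrow> ('b \<Rightarrow> 'r) \<Rightarrow> 'b \<Rightarrow> 'r::zero" where
  "extend_by_zero \<Sigma> f = (\<lambda>\<sigma>. if \<sigma> \<in> arrows \<Sigma> then f \<sigma> else 0)"

section \<open>Graded rings\<close>

text \<open>The ring is the whole type \<open>'q\<close>, not assumed unital. The third condition says that it is
  the internal direct sum of the components.\<close>

locale graded_ring =
  fixes Q :: "'g::group_add \<Rightarrow> 'q::ring set"
  assumes component_subgroup: "0 \<in> Q \<gamma>" "x \<in> Q \<gamma> \<Longrightarrow> y \<in> Q \<gamma> \<Longrightarrow> x - y \<in> Q \<gamma>"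
    and component_mult: "x \<in> Q \<gamma> \<Longrightarrow> y \<in> Q \<delta> \<Longrightarrow> x * y \<in> Q (\<gamma> + \<delta>)"
    and direct_sum: "\<exists>!h. (\<forall>\<gamma>. h \<gamma> \<in> Q \<gamma>) \<and> finite {\<gamma>. h \<gamma> \<noteq> 0} \<and> x = (\<Sum>\<gamma> | h \<gamma> \<noteq> 0. h \<gamma>)"

definition graded_ring_hom :: "'a tgroupoid \<Rightarrow> 'b tgroupoid \<Rightarrow>
    ('a \<times> 'r::{comm_ring, monoid_mult} \<Rightarrow> 'b) \<Rightarrow> ('b \<Rightarrow> 'a) \<Rightarrow> ('a \<Rightarrow> 'g) \<Rightarrow>
    ('g \<Rightarrow> 'q::ring set) \<Rightarrow> (('b \<Rightarrow> 'r) \<Rightarrow> 'q) \<Rightarrow> bool" where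
  "graded_ring_hom G \<Sigma> i q c\<^sub>G Q \<pi> \<longleftrightarrow>
     (\<forall>f\<in>twisted_steinberg G \<Sigma> i q. \<forall>g\<in>twisted_steinberg G \<Sigma> i q.
        \<pi> (\<lambda>\<sigma>. f \<sigma> + g \<sigma>) = \<pi> f + \<pi> g \<and> \<pi> (twisted_conv G \<Sigma> q f g) = \<pi> f * \<pi> g) \<and>
     (\<forall>\<gamma>. \<forall>f\<in>steinberg_component G \<Sigma> i q c\<^sub>G \<gamma>. \<pi> f \<in> Q \<gamma>)"

end

theory Submission
  imports Defs
begin

text \<open>Only the injectivity of $\pi$ from its behaviour on the isotropy needs work. It is enough to
  turn a nonzero $f$ with $\pi(f) = 0$ into a nonzero $h$ with $\pi(h) = 0$ and with support in
  $\mathrm{Iso}(G_\epsilon)^\circ$.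

  First, $f$ may be taken homogeneous, because the components of $Q$ form a direct sum
  (\<open>kernel_homogeneous\<close>). Next, if $\alpha$ is in the support of $f$, let $B$ be a compact open
  bisection around $\alpha^{-1}$ on which $q$ has a continuous section, and $n$ the corresponding
  function on $\Sigma$. Then $n * f$ has $s(\alpha)$ in its support and lives on
  $G_\epsilon$ (\<open>translate_to_unit\<close>).

  So let $D = \mathrm{supp}_G(f)$ be contained in $G_\epsilon$ and contain a unit. The support $D$ is
  both compact and open. The isotropy arrows of $D$ outside $\mathrm{Iso}(G)^\circ$ form a compact set
  without interior, and covering it by finitely many bisections shows that its range contains
  no nonempty open set of units (\<open>rng_nowhere_dense\<close>). Hence some unit
  $y \in D$ is not in this range. No arrow of $D \setminus \mathrm{Iso}(G)^\circ$ then both begins and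
  ends at $y$, and by compactness none both begins and ends in a small enough compact open set $K$ of
  units around $y$ (\<open>compress_to_Iso_interior\<close>). With $1_K$ the function in the algebra
  that corresponds to the indicator of $K$, the product $1_K * f * 1_K$ is the restriction of $f$ to
  the arrows that begin and end in $K$ (\<open>compress\<close>). Its support is open, lies in
  $\mathrm{Iso}(G_\epsilon)$ and contains $y$, so it is the required $h$.

  Two facts about the twist support this. A continuous local section of $q$ is an open map
  (\<open>open_section_image\<close>), so it defines a locally constant function; and
  $\mathrm{supp}_G(f)$ is open and closed (\<open>supp\<^sub>G_clopen\<close>), which
  also identifies the algebra of $\mathrm{Iso}(G_\epsilon)^\circ$ inside the large algebra
  (\<open>twisted_steinberg_Iso_interior\<close>).\<close>

section \<open>Arithmetic and topology of groupoids\<close>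

context topological_groupoid
begin

lemma composable_arrows:
  assumes "(\<alpha>, \<beta>) \<in> composable G"
  shows "\<alpha> \<in> arrows G" "\<beta> \<in> arrows G"
  using assms composable_subset by auto

lemma composable_ginv_left: "\<alpha> \<in> arrows G \<Longrightarrow> (ginv G \<alpha>, \<alpha>) \<in> composable G"
  using composable_ginv[of "ginv G \<alpha>"] by (simp add: ginv_closed ginv_ginv)

lemma rng_closed: "\<alpha> \<in> arrows G \<Longrightarrow> rng G \<alpha> \<in> arrows G"
  by (simp add: rng_def gmult_closed composable_ginv)

lemma src_closed: "\<alpha> \<in> arrows G \<Longrightarrow> src G \<alpha> \<in> arrows G"
  by (simp add: src_def gmult_closed composable_ginv_left)

lemma rng_ginv: "\<alpha> \<in> arrows G \<Longrightarrow> rng G (ginv G \<alpha>) = src G \<alpha>"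
  by (simp add: rng_def src_def ginv_ginv)

lemma src_ginv: "\<alpha> \<in> arrows G \<Longrightarrow> src G (ginv G \<alpha>) = rng G \<alpha>"
  by (simp add: rng_def src_def ginv_ginv)

lemma rng_gmult_self:
  assumes "\<alpha> \<in> arrows G"
  shows "(rng G \<alpha>, \<alpha>) \<in> composable G" "gmult G (rng G \<alpha>) \<alpha> = \<alpha>"
  using composable_assoc[OF composable_ginv[OF assms] composable_ginv_left[OF assms]]
    cancel_right[OF composable_ginv[OF assms]] assms
  by (auto simp: rng_def ginv_ginv)

lemma gmult_src_self:
  assumes "\<alpha> \<in> arrows G"
  shows "(\<alpha>, src G \<alpha>) \<in> composable G" "gmult G \<alpha> (src G \<alpha>) = \<alpha>"
  using composable_assoc[OF composable_ginv[OF assms] composable_ginv_left[OF assms]]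
    rng_gmult_self(2)[OF assms]
  by (auto simp: src_def rng_def)

text \<open>If $\alpha\beta$ is defined, bracketing $\alpha^{-1}\alpha\beta\beta^{-1}$ in two ways
  gives $s(\alpha) = r(\beta)$; conversely $\alpha s(\alpha)$ and $r(\beta)\beta$ are always
  defined, and associativity glues them.\<close>

lemma composable_iff:
  "(\<alpha>, \<beta>) \<in> composable G \<longleftrightarrow> \<alpha> \<in> arrows G \<and> \<beta> \<in> arrows G \<and> src G \<alpha> = rng G \<beta>"
proof
  assume c: "(\<alpha>, \<beta>) \<in> composable G"
  note ar = composable_arrows[OF c]
  have 1: "(ginv G \<alpha>, gmult G \<alpha> \<beta>) \<in> composable G"
    using composable_assoc[OF composable_ginv_left[OF ar(1)] c] by simp
  have 2: "(gmult G \<alpha> \<beta>, ginv G \<beta>) \<in> composable G"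
    using composable_assoc[OF c composable_ginv[OF ar(2)]] by simp
  show "\<alpha> \<in> arrows G \<and> \<beta> \<in> arrows G \<and> src G \<alpha> = rng G \<beta>"
    using composable_assoc[OF 1 2] cancel_left[OF c] cancel_right[OF c] ar
    by (simp add: src_def rng_def)
next
  assume a: "\<alpha> \<in> arrows G \<and> \<beta> \<in> arrows G \<and> src G \<alpha> = rng G \<beta>"
  have 1: "(\<alpha>, rng G \<beta>) \<in> composable G"
    using a gmult_src_self(1)[of \<alpha>] by simp
  have 2: "(rng G \<beta>, \<beta>) \<in> composable G"
    using a rng_gmult_self(1) by simp
  show "(\<alpha>, \<beta>) \<in> composable G"
    using composable_assoc[OF 1 2] rng_gmult_self(2)[of \<beta>] a by simp
qed

lemma rng_gmult:
  assumes "(\<alpha>, \<beta>) \<in> composable G"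
  shows "rng G (gmult G \<alpha> \<beta>) = rng G \<alpha>"
proof -
  have "(ginv G \<alpha>, gmult G \<alpha> \<beta>) \<in> composable G"
    using composable_assoc[OF composable_ginv_left assms] composable_arrows[OF assms] by simp
  then show ?thesis
    using composable_arrows[OF assms] by (simp add: composable_iff src_ginv)
qed

lemma src_gmult:
  assumes "(\<alpha>, \<beta>) \<in> composable G"
  shows "src G (gmult G \<alpha> \<beta>) = src G \<beta>"
proof -
  have "(gmult G \<alpha> \<beta>, ginv G \<beta>) \<in> composable G"
    using composable_assoc[OF assms composable_ginv] composable_arrows[OF assms] by simp
  then show ?thesis
    using composable_arrows[OF assms] by (simp add: composable_iff rng_ginv)
qed

lemma rng_rng: "\<alpha> \<in> arrows G \<Longrightarrow> rng G (rng G \<alpha>) = rng G \<alpha>"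
  using rng_gmult[OF composable_ginv] by (simp add: rng_def)

lemma src_rng: "\<alpha> \<in> arrows G \<Longrightarrow> src G (rng G \<alpha>) = rng G \<alpha>"
  using rng_gmult_self(1) composable_iff by blast

lemma rng_src: "\<alpha> \<in> arrows G \<Longrightarrow> rng G (src G \<alpha>) = src G \<alpha>"
  using gmult_src_self(1) composable_iff by metis

lemma src_src: "\<alpha> \<in> arrows G \<Longrightarrow> src G (src G \<alpha>) = src G \<alpha>"
  by (metis ginv_closed rng_ginv src_rng)

lemma rng_unit: "\<alpha> \<in> arrows G \<Longrightarrow> rng G \<alpha> \<in> unit_space G"
  by (simp add: unit_space_def)

lemma src_unit: "\<alpha> \<in> arrows G \<Longrightarrow> src G \<alpha> \<in> unit_space G"
  by (metis ginv_closed rng_ginv rng_unit)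

lemma unit_space_iff: "x \<in> unit_space G \<longleftrightarrow> x \<in> arrows G \<and> rng G x = x"
  unfolding unit_space_def using rng_closed rng_rng by force

lemma src_of_unit: "x \<in> unit_space G \<Longrightarrow> src G x = x"
  by (metis src_rng unit_space_iff)

lemma ginv_gmult_eq:
  assumes "(\<alpha>, \<beta>) \<in> composable G"
  shows "ginv G (gmult G \<alpha> \<beta>) = gmult G (ginv G \<beta>) (ginv G \<alpha>)"
proof -
  note ar = composable_arrows[OF assms]
  let ?m = "gmult G \<alpha> \<beta>"
  have m: "?m \<in> arrows G" using gmult_closed[OF assms] .
  have c1: "(ginv G ?m, ?m) \<in> composable G" using composable_ginv_left[OF m] .
  have c2: "(?m, ginv G \<beta>) \<in> composable G"
    using ar m assms by (simp add: composable_iff ginv_closed src_gmult rng_ginv)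
  have c3: "(ginv G ?m, \<alpha>) \<in> composable G"
    using ar m assms by (simp add: composable_iff ginv_closed src_ginv rng_gmult)
  have "gmult G (ginv G ?m) \<alpha> = ginv G \<beta>"
    using cancel_left[OF c2] cancel_right[OF assms] by simp
  then show ?thesis using cancel_right[OF c3] by simp
qed

lemma ginv_of_unit: "x \<in> unit_space G \<Longrightarrow> ginv G x = x"
  using gmult_src_self(2)[of "ginv G x"]
  by (metis ginv_closed src_ginv unit_space_iff src_def src_of_unit)

lemma continuous_rng: "continuous_map (gtop G) (gtop G) (rng G)"
proof -
  have "continuous_map (gtop G) (prod_topology (gtop G) (gtop G)) (\<lambda>\<alpha>. (\<alpha>, ginv G \<alpha>))"
    by (intro continuous_map_pairedI continuous_ginv) simp
  then have "continuous_map (gtop G)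
      (subtopology (prod_topology (gtop G) (gtop G)) (composable G)) (\<lambda>\<alpha>. (\<alpha>, ginv G \<alpha>))"
    by (auto simp: continuous_map_in_subtopology composable_ginv arrows_def)
  from continuous_map_compose[OF this continuous_gmult] show ?thesis
    by (simp add: o_def rng_def[abs_def])
qed

lemma continuous_src: "continuous_map (gtop G) (gtop G) (src G)"
proof -
  have "continuous_map (gtop G) (gtop G) (rng G \<circ> ginv G)"
    using continuous_ginv continuous_rng by (rule continuous_map_compose)
  then show ?thesis
    by (rule continuous_map_eq) (simp add: rng_ginv arrows_def)
qed

lemma continuous_gmult_compose:
  assumes "continuous_map X (gtop G) f" "continuous_map X (gtop G) g"
    and "\<And>x. x \<in> topspace X \<Longrightarrow> (f x, g x) \<in> composable G"
  shows "continuous_map X (gtop G) (\<lambda>x. gmult G (f x) (g x))"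
proof -
  have "continuous_map X (subtopology (prod_topology (gtop G) (gtop G)) (composable G))
      (\<lambda>x. (f x, g x))"
    using assms by (auto simp: continuous_map_in_subtopology intro!: continuous_map_pairedI)
  from continuous_map_compose[OF this continuous_gmult] show ?thesis
    by (simp add: o_def)
qed

lemma unit_space_subset: "unit_space G \<subseteq> arrows G"
  using unit_space_iff by blast

lemma topspace_unit_top: "topspace (unit_top G) = unit_space G"
  using unit_space_subset by (auto simp: unit_top_def arrows_def)

end

section \<open>Local injectivity, bisections and the unit space\<close>

context etale_groupoid
begin

lemma src_locally_injective:
  assumes "\<alpha> \<in> arrows G"
  obtains U where "openin (gtop G) U" "\<alpha> \<in> U" "inj_on (src G) U"
proof -
  obtain U where U: "openin (gtop G) U" "\<alpha> \<in> U"
     "homeomorphic_map (subtopology (gtop G) U) (subtopology (unit_top G) (src G ` U)) (src G)"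
    using local_homeomorphism_src assms unfolding local_homeomorphism_def arrows_def by blast
  have "inj_on (src G) (topspace (subtopology (gtop G) U))"
    using U(3) homeomorphic_imp_injective_map by blast
  then have "inj_on (src G) U"
    using openin_subset[OF U(1)] by (simp add: Int_absorb1)
  with U that show thesis by blast
qed

text \<open>Near a unit $u$ the source map is injective on some open $U$; an arrow of $U$ whose source
  is again in $U$ has the same source as that source and so must be a unit.\<close>

lemma open_unit_space: "openin (gtop G) (unit_space G)"
proof (subst openin_subopen, intro ballI)
  fix u assume u: "u \<in> unit_space G"
  then obtain U where U: "openin (gtop G) U" "u \<in> U" "inj_on (src G) U"
    using src_locally_injective unit_space_subset by blast
  define V where "V = U \<inter> {\<alpha> \<in> topspace (gtop G). src G \<alpha> \<in> U}"
  have "openin (gtop G) V"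
    unfolding V_def using continuous_src U(1) openin_continuous_map_preimage by blast
  moreover have "u \<in> V"
    using u U(2) unit_space_subset by (auto simp: V_def src_of_unit arrows_def)
  moreover have "V \<subseteq> unit_space G"
  proof
    fix \<alpha> assume "\<alpha> \<in> V"
    then have "\<alpha> \<in> arrows G" "\<alpha> \<in> U" "src G \<alpha> \<in> U" by (auto simp: V_def arrows_def)
    then have "src G \<alpha> = \<alpha>" using U(3) src_src by (metis inj_onD)
    then show "\<alpha> \<in> unit_space G" using \<open>\<alpha> \<in> arrows G\<close> src_unit by metis
  qed
  ultimately show "\<exists>T. openin (gtop G) T \<and> u \<in> T \<and> T \<subseteq> unit_space G" by blast
qed

end

lemma (in topological_groupoid) closed_Iso:
  assumes "Hausdorff_space (gtop G)"
  shows "closedin (gtop G) (Iso G)"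
  using closedin_continuous_maps_eq[OF assms continuous_rng continuous_src]
  by (simp add: Iso_def arrows_def)

lemma (in topological_groupoid) closed_composable:
  assumes "Hausdorff_space (gtop G)"
  shows "closedin (prod_topology (gtop G) (gtop G)) (composable G)"
proof -
  have eq: "composable G = {p \<in> topspace (prod_topology (gtop G) (gtop G)).
      (src G \<circ> fst) p = (rng G \<circ> snd) p}"
    by (auto simp: composable_iff arrows_def)
  show ?thesis unfolding eq
    by (intro closedin_continuous_maps_eq[OF assms]
        continuous_map_compose[OF continuous_map_fst continuous_src]
        continuous_map_compose[OF continuous_map_snd continuous_rng])
qed


lemma (in etale_groupoid) inj_rng_bisection: "open_bisection G B \<Longrightarrow> inj_on (rng G) B"
  by (metis homeomorphic_imp_injective_map inf.absorb2 open_bisection_def openin_subset topspace_subtopology)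

lemma (in ample_groupoid) finite_bisection_cover:
  assumes "compactin (gtop G) D"
  obtains \<F> where "finite \<F>" "D \<subseteq> \<Union>\<F>"
    "\<And>B. B \<in> \<F> \<Longrightarrow> open_bisection G B \<and> compactin (gtop G) B"
proof -
  let ?\<U> = "{B. open_bisection G B \<and> compactin (gtop G) B}"
  have "D \<subseteq> \<Union>?\<U>"
  proof
    fix \<alpha> assume "\<alpha> \<in> D"
    then have "\<alpha> \<in> topspace (gtop G)" using compactin_subset_topspace[OF assms] by blast
    from basis_compact_open_bisections[OF openin_topspace this]
    show "\<alpha> \<in> \<Union>?\<U>" by blast
  qed
  moreover have "openin (gtop G) B" if "B \<in> ?\<U>" for B using that by (simp add: open_bisection_def)
  ultimately have "\<exists>\<F>. finite \<F> \<and> \<F> \<subseteq> ?\<U> \<and> D \<subseteq> \<Union>\<F>"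
    by (intro compactinD[OF assms])
  then obtain \<F> where "finite \<F>" "\<F> \<subseteq> ?\<U>" "D \<subseteq> \<Union>\<F>" by blast
  with that[of \<F>] show thesis by blast
qed

lemma (in ample_groupoid) finite_compact_inter_fibre:
  assumes "compactin (gtop G) D"
  shows "finite {\<alpha> \<in> D. rng G \<alpha> = x}"
proof -
  obtain \<F> where \<F>: "finite \<F>" "D \<subseteq> \<Union>\<F>"
    "\<And>B. B \<in> \<F> \<Longrightarrow> open_bisection G B \<and> compactin (gtop G) B"
    using finite_bisection_cover[OF assms] by blast
  have "finite {\<alpha> \<in> B. rng G \<alpha> = x}" if "B \<in> \<F>" for B
  proof (rule finite_subset)
    have inj: "inj_on (rng G) B" using \<F>(3)[OF that] inj_rng_bisection by blast
    show "{\<alpha> \<in> B. rng G \<alpha> = x} \<subseteq> {inv_into B (rng G) x}"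
      using inv_into_f_f[OF inj] by auto
  qed simp
  then have "finite (\<Union>B\<in>\<F>. {\<alpha> \<in> B. rng G \<alpha> = x})" by (rule finite_UN_I[OF \<F>(1)])
  moreover have "{\<alpha> \<in> D. rng G \<alpha> = x} \<subseteq> (\<Union>B\<in>\<F>. {\<alpha> \<in> B. rng G \<alpha> = x})" using \<F>(2) by blast
  ultimately show ?thesis by (rule finite_subset[rotated])
qed

section \<open>Units of the coefficient ring\<close>

lemma unit_inverse_unique:
  fixes t u :: "'r::{comm_ring, monoid_mult}"
  assumes "t * u = 1"
  shows "unit_inverse t = u"
  unfolding unit_inverse_def
proof (rule the_equality)
  show "t * u = 1" by (rule assms)
next
  fix v assume "t * v = 1"
  then have "v = u * t * v" using assms by (simp add: mult.commute)
  also have "\<dots> = u" using \<open>t * v = 1\<close> by (simp add: mult.assoc)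
  finally show "v = u" .
qed

lemma unit_inverse_right:
  fixes t :: "'r::{comm_ring, monoid_mult}"
  assumes "t \<in> ring_units"
  shows "t * unit_inverse t = 1"
  using assms unit_inverse_unique unfolding ring_units_def by blast

lemma unit_inverse_units:
  fixes t :: "'r::{comm_ring, monoid_mult}"
  assumes "t \<in> ring_units"
  shows "unit_inverse t \<in> ring_units"
  using unit_inverse_right[OF assms] unfolding ring_units_def by (metis (mono_tags) mem_Collect_eq mult.commute)

lemma one_ring_units: "(1 :: 'r::{comm_ring, monoid_mult}) \<in> ring_units"
  unfolding ring_units_def by (auto intro: exI[of _ 1])

lemma mult_ring_units:
  fixes t u :: "'r::{comm_ring, monoid_mult}"
  assumes "t \<in> ring_units" "u \<in> ring_units"
  shows "t * u \<in> ring_units"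
proof -
  have "t * u * (unit_inverse t * unit_inverse u) = (t * unit_inverse t) * (u * unit_inverse u)"
    by (simp add: ac_simps)
  also have "\<dots> = 1" using assms by (simp add: unit_inverse_right)
  finally show ?thesis unfolding ring_units_def by blast
qed

lemma unit_inverse_inverse:
  fixes t :: "'r::{comm_ring, monoid_mult}"
  assumes "t \<in> ring_units"
  shows "unit_inverse (unit_inverse t) = t"
  by (rule unit_inverse_unique) (metis assms mult.commute unit_inverse_right)

lemma unit_inverse_mult:
  fixes t u :: "'r::{comm_ring, monoid_mult}"
  assumes "t \<in> ring_units" "u \<in> ring_units"
  shows "unit_inverse (t * u) = unit_inverse t * unit_inverse u"
proof (rule unit_inverse_unique)
  have "t * u * (unit_inverse t * unit_inverse u) = (t * unit_inverse t) * (u * unit_inverse u)"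
    by (simp add: ac_simps)
  also have "\<dots> = 1" using assms by (simp add: unit_inverse_right)
  finally show "t * u * (unit_inverse t * unit_inverse u) = 1" .
qed

lemma unit_mult_eq_0_iff:
  fixes t :: "'r::{comm_ring, monoid_mult}"
  assumes "t \<in> ring_units"
  shows "t * a = 0 \<longleftrightarrow> a = 0"
proof
  assume "t * a = 0"
  then have "unit_inverse t * t * a = 0" by (simp add: mult.assoc)
  then show "a = 0" using unit_inverse_right[OF assms] by (simp add: mult.commute)
qed simp

section \<open>Discrete twists\<close>

context discrete_twist
begin

abbreviation act :: "'r \<Rightarrow> 'b \<Rightarrow> 'b" where "act \<equiv> twist_act \<Sigma> i q"

lemma q_closed: "\<sigma> \<in> arrows \<Sigma> \<Longrightarrow> q \<sigma> \<in> arrows G"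
  using DT1_surj by blast

lemma q_gmult:
  assumes "(\<sigma>, \<tau>) \<in> composable \<Sigma>"
  shows "(q \<sigma>, q \<tau>) \<in> composable G" "q (gmult \<Sigma> \<sigma> \<tau>) = gmult G (q \<sigma>) (q \<tau>)"
  using hom_q assms unfolding continuous_groupoid_hom_def by auto

lemma q_unit:
  assumes "x \<in> unit_space \<Sigma>"
  shows "q x \<in> unit_space G"
  using continuous_map_image_subset_topspace[OF homeomorphic_imp_continuous_map[OF homeo_q]] assms
  unfolding G.topspace_unit_top \<Sigma>.topspace_unit_top by blast

lemma inj_q_units: "inj_on q (unit_space \<Sigma>)"
  using homeomorphic_imp_injective_map[OF homeo_q] by (simp add: \<Sigma>.topspace_unit_top)

lemma q_rng:
  assumes "\<sigma> \<in> arrows \<Sigma>"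
  shows "q (rng \<Sigma> \<sigma>) = rng G (q \<sigma>)"
proof -
  note c = \<Sigma>.composable_ginv[OF assms]
  have u: "q (rng \<Sigma> \<sigma>) \<in> unit_space G" using assms by (simp add: \<Sigma>.rng_unit q_unit)
  have "rng G (q (rng \<Sigma> \<sigma>)) = rng G (q \<sigma>)"
    unfolding rng_def[of \<Sigma>] q_gmult(2)[OF c] using q_gmult(1)[OF c] by (rule G.rng_gmult)
  with u show ?thesis by (simp add: G.unit_space_iff)
qed

lemma q_src:
  assumes "\<sigma> \<in> arrows \<Sigma>"
  shows "q (src \<Sigma> \<sigma>) = src G (q \<sigma>)"
proof -
  note c = \<Sigma>.composable_ginv_left[OF assms]
  have u: "q (src \<Sigma> \<sigma>) \<in> unit_space G" using assms by (simp add: \<Sigma>.src_unit q_unit)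
  have "src G (q (src \<Sigma> \<sigma>)) = src G (q \<sigma>)"
    unfolding src_def[of \<Sigma>] q_gmult(2)[OF c] using q_gmult(1)[OF c] by (rule G.src_gmult)
  with u show ?thesis by (simp add: G.src_of_unit)
qed

lemma q_ginv:
  assumes "\<sigma> \<in> arrows \<Sigma>"
  shows "q (ginv \<Sigma> \<sigma>) = ginv G (q \<sigma>)"
proof -
  note c = \<Sigma>.composable_ginv[OF assms]
  have "gmult G (ginv G (q \<sigma>)) (gmult G (q \<sigma>) (q (ginv \<Sigma> \<sigma>))) = q (ginv \<Sigma> \<sigma>)"
    using q_gmult(1)[OF c] by (rule G.cancel_left)
  moreover have "gmult G (q \<sigma>) (q (ginv \<Sigma> \<sigma>)) = rng G (q \<sigma>)"
    using q_gmult(2)[OF c] q_rng[OF assms] by (simp add: rng_def)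
  moreover have "gmult G (ginv G (q \<sigma>)) (rng G (q \<sigma>)) = ginv G (q \<sigma>)"
    using G.gmult_src_self(2)[of "ginv G (q \<sigma>)"] assms
    by (simp add: G.ginv_closed q_closed G.src_ginv)
  ultimately show ?thesis by simp
qed

text \<open>Because $q$ is injective on units, the sources and ranges in $\Sigma$ are those of $G$; this
  reduces every question of composability in $\Sigma$ to one in $G$.\<close>

lemma composable_\<Sigma>_iff:
  assumes "\<sigma> \<in> arrows \<Sigma>" "\<tau> \<in> arrows \<Sigma>"
  shows "(\<sigma>, \<tau>) \<in> composable \<Sigma> \<longleftrightarrow> src G (q \<sigma>) = rng G (q \<tau>)"
proof -
  have "src \<Sigma> \<sigma> = rng \<Sigma> \<tau> \<longleftrightarrow> q (src \<Sigma> \<sigma>) = q (rng \<Sigma> \<tau>)"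
    using inj_on_eq_iff[OF inj_q_units \<Sigma>.src_unit \<Sigma>.rng_unit] assms by simp
  then show ?thesis using assms by (simp add: \<Sigma>.composable_iff q_src q_rng)
qed

lemma i_closed:
  assumes "x \<in> unit_space G" "t \<in> ring_units"
  shows "i (x, t) \<in> arrows \<Sigma>" "q (i (x, t)) = x"
  using DT1_exact[OF assms(1)] assms(2) by blast+

lemma i_one_unit: "x \<in> unit_space G \<Longrightarrow> i (x, 1) \<in> unit_space \<Sigma>"
  using unit_space_\<Sigma> by blast

lemma i_gmult:
  assumes "x \<in> unit_space G" "t \<in> ring_units" "u \<in> ring_units"
  shows "i (x, t * u) = gmult \<Sigma> (i (x, t)) (i (x, u))"
  using hom_i assms unfolding continuous_groupoid_hom_def trivial_bundle_def by fastforce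

lemma unit_eq_i: "x \<in> unit_space \<Sigma> \<Longrightarrow> i (q x, 1) = x"
  by (metis i_closed(2) i_one_unit inj_onD inj_q_units one_ring_units q_unit)

lemma rng_eq_i: "\<sigma> \<in> arrows \<Sigma> \<Longrightarrow> rng \<Sigma> \<sigma> = i (rng G (q \<sigma>), 1)"
  by (metis \<Sigma>.rng_unit q_rng unit_eq_i)

lemma src_eq_i: "\<sigma> \<in> arrows \<Sigma> \<Longrightarrow> src \<Sigma> \<sigma> = i (src G (q \<sigma>), 1)"
  by (metis \<Sigma>.src_unit q_src unit_eq_i)

lemma act_eq: "\<sigma> \<in> arrows \<Sigma> \<Longrightarrow> act t \<sigma> = gmult \<Sigma> (i (rng G (q \<sigma>), t)) \<sigma>"
  by (simp add: twist_act_def q_rng)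

lemma act_eq_right:
  "\<sigma> \<in> arrows \<Sigma> \<Longrightarrow> t \<in> ring_units \<Longrightarrow> act t \<sigma> = gmult \<Sigma> \<sigma> (i (src G (q \<sigma>), t))"
  using DT3 by (simp add: twist_act_def q_src)

lemma rng_q_unit: "\<sigma> \<in> arrows \<Sigma> \<Longrightarrow> rng G (q \<sigma>) \<in> unit_space G"
  by (simp add: G.rng_unit q_closed)

lemma src_q_unit: "\<sigma> \<in> arrows \<Sigma> \<Longrightarrow> src G (q \<sigma>) \<in> unit_space G"
  by (simp add: G.src_unit q_closed)

lemma i_composable:
  assumes "\<sigma> \<in> arrows \<Sigma>" "t \<in> ring_units"
  shows "(i (rng G (q \<sigma>), t), \<sigma>) \<in> composable \<Sigma>"
  using assms rng_q_unit[OF assms(1)]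
  by (simp add: composable_\<Sigma>_iff i_closed G.src_of_unit)

lemma act_closed:
  assumes "\<sigma> \<in> arrows \<Sigma>" "t \<in> ring_units"
  shows "act t \<sigma> \<in> arrows \<Sigma>" "q (act t \<sigma>) = q \<sigma>"
  using \<Sigma>.gmult_closed[OF i_composable[OF assms]] q_gmult(2)[OF i_composable[OF assms]] assms
    G.rng_gmult_self(2)[of "q \<sigma>"]
  by (simp_all add: act_eq i_closed rng_q_unit q_closed)

lemma act_act:
  assumes "\<sigma> \<in> arrows \<Sigma>" "t \<in> ring_units" "u \<in> ring_units"
  shows "act t (act u \<sigma>) = act (t * u) \<sigma>"
proof -
  let ?x = "rng G (q \<sigma>)"
  have "(i (?x, t), i (?x, u)) \<in> composable \<Sigma>"
    using assms rng_q_unit[OF assms(1)]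
    by (simp add: composable_\<Sigma>_iff i_closed G.src_of_unit G.unit_space_iff)
  from \<Sigma>.composable_assoc[OF this i_composable[OF assms(1,3)]]
  have "gmult \<Sigma> (gmult \<Sigma> (i (?x, t)) (i (?x, u))) \<sigma> = gmult \<Sigma> (i (?x, t)) (act u \<sigma>)"
    by (simp only: act_eq[OF assms(1)])
  then show ?thesis using assms
    by (simp add: act_eq[of \<sigma> "t * u"] act_eq[of "act u \<sigma>"] act_closed i_gmult rng_q_unit)
qed

lemma act_gmult_left:
  assumes "(\<sigma>, \<tau>) \<in> composable \<Sigma>" "t \<in> ring_units"
  shows "(act t \<sigma>, \<tau>) \<in> composable \<Sigma>" "gmult \<Sigma> (act t \<sigma>) \<tau> = act t (gmult \<Sigma> \<sigma> \<tau>)"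
proof -
  note ar = \<Sigma>.composable_arrows[OF assms(1)]
  have "rng G (q (gmult \<Sigma> \<sigma> \<tau>)) = rng G (q \<sigma>)"
    using q_gmult[OF assms(1)] by (simp add: G.rng_gmult)
  then show "(act t \<sigma>, \<tau>) \<in> composable \<Sigma>" "gmult \<Sigma> (act t \<sigma>) \<tau> = act t (gmult \<Sigma> \<sigma> \<tau>)"
    using \<Sigma>.composable_assoc[OF i_composable[OF ar(1) assms(2)] assms(1)] ar
      \<Sigma>.gmult_closed[OF assms(1)]
    by (simp_all add: act_eq)
qed

lemma act_gmult_right:
  assumes "(\<sigma>, \<tau>) \<in> composable \<Sigma>" "t \<in> ring_units"
  shows "(\<sigma>, act t \<tau>) \<in> composable \<Sigma>" "gmult \<Sigma> \<sigma> (act t \<tau>) = act t (gmult \<Sigma> \<sigma> \<tau>)"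
proof -
  note ar = \<Sigma>.composable_arrows[OF assms(1)]
  have s: "src G (q (gmult \<Sigma> \<sigma> \<tau>)) = src G (q \<tau>)"
    using q_gmult[OF assms(1)] by (simp add: G.src_gmult)
  have "(\<tau>, i (src G (q \<tau>), t)) \<in> composable \<Sigma>"
    using assms(2) ar src_q_unit[OF ar(2)]
    by (simp add: composable_\<Sigma>_iff i_closed G.unit_space_iff)
  from \<Sigma>.composable_assoc[OF assms(1) this]
  show "(\<sigma>, act t \<tau>) \<in> composable \<Sigma>" "gmult \<Sigma> \<sigma> (act t \<tau>) = act t (gmult \<Sigma> \<sigma> \<tau>)"
    using ar assms(2) \<Sigma>.gmult_closed[OF assms(1)] s by (simp_all add: act_eq_right)
qed

lemma ginv_i:
  assumes "x \<in> unit_space G" "t \<in> ring_units"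
  shows "ginv \<Sigma> (i (x, t)) = i (x, unit_inverse t)"
proof -
  note t' = unit_inverse_units[OF assms(2)]
  have c: "(i (x, t), i (x, unit_inverse t)) \<in> composable \<Sigma>"
    using assms t' by (simp add: composable_\<Sigma>_iff i_closed G.src_of_unit G.unit_space_iff)
  have "gmult \<Sigma> (i (x, t)) (i (x, unit_inverse t)) = i (x, 1)"
    using i_gmult[OF assms t'] unit_inverse_right[OF assms(2)] by simp
  also have "\<dots> = rng \<Sigma> (i (x, t))"
    using assms by (simp add: rng_eq_i i_closed G.unit_space_iff)
  also have "\<dots> = src \<Sigma> (ginv \<Sigma> (i (x, t)))"
    using assms by (simp add: i_closed \<Sigma>.src_ginv)
  finally show ?thesis
    using \<Sigma>.cancel_left[OF c] \<Sigma>.gmult_src_self(2)[of "ginv \<Sigma> (i (x, t))"] assms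
    by (simp add: i_closed \<Sigma>.ginv_closed)
qed

lemma act_ginv:
  assumes "\<sigma> \<in> arrows \<Sigma>" "t \<in> ring_units"
  shows "ginv \<Sigma> (act t \<sigma>) = act (unit_inverse t) (ginv \<Sigma> \<sigma>)"
  using \<Sigma>.ginv_gmult_eq[OF i_composable[OF assms]] assms
  by (simp add: act_eq[OF assms(1)] act_eq_right \<Sigma>.ginv_closed unit_inverse_units ginv_i
      rng_q_unit q_ginv G.src_ginv q_closed)

text \<open>Two arrows over the same arrow of $G$ differ by an element of the kernel of $q$, which is the
  bundle of copies of $R^\times$.\<close>

lemma same_q_imp_act:
  assumes "\<sigma> \<in> arrows \<Sigma>" "\<tau> \<in> arrows \<Sigma>" "q \<sigma> = q \<tau>"
  obtains t where "t \<in> ring_units" "\<sigma> = act t \<tau>"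
proof -
  let ?k = "gmult \<Sigma> \<sigma> (ginv \<Sigma> \<tau>)"
  have c: "(\<sigma>, ginv \<Sigma> \<tau>) \<in> composable \<Sigma>"
    using assms by (simp add: composable_\<Sigma>_iff \<Sigma>.ginv_closed q_ginv G.rng_ginv q_closed)
  have "q ?k = rng G (q \<tau>)"
    using q_gmult(2)[OF c] assms by (simp add: q_ginv rng_def)
  then have "?k \<in> i ` ({rng G (q \<tau>)} \<times> ring_units)"
    using DT1_exact[OF rng_q_unit[OF assms(2)]] \<Sigma>.gmult_closed[OF c] by blast
  then obtain t where t: "t \<in> ring_units" "?k = i (rng G (q \<tau>), t)" by blast
  have "act t \<tau> = gmult \<Sigma> ?k \<tau>" using t assms by (simp add: act_eq)
  also have "\<dots> = \<sigma>" using \<Sigma>.cancel_right[OF c] assms(2) by (simp add: \<Sigma>.ginv_ginv)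
  finally show thesis using t(1) that by metis
qed

lemma act_inj:
  assumes "\<sigma> \<in> arrows \<Sigma>" "t \<in> ring_units" "u \<in> ring_units" "act t \<sigma> = act u \<sigma>"
  shows "t = u"
proof -
  have "gmult \<Sigma> (i (rng G (q \<sigma>), t)) \<sigma> = gmult \<Sigma> (i (rng G (q \<sigma>), u)) \<sigma>"
    using assms(4) by (simp only: act_eq[OF assms(1)])
  then have "i (rng G (q \<sigma>), t) = i (rng G (q \<sigma>), u)"
    using \<Sigma>.cancel_right[OF i_composable[OF assms(1,2)]]
      \<Sigma>.cancel_right[OF i_composable[OF assms(1,3)]] by metis
  from inj_onD[OF DT1_inj this] show ?thesis
    using rng_q_unit[OF assms(1)] assms(2,3) by simp
qed

lemma continuous_q: "continuous_map (gtop \<Sigma>) (gtop G) q"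
  using hom_q by (simp add: continuous_groupoid_hom_def)

lemma unit_trivial_bundle:
  "gtop (trivial_bundle G :: ('a \<times> 'r) tgroupoid)
     = prod_topology (unit_top G) (discrete_topology ring_units)"
  by (simp add: trivial_bundle_def)

lemma continuous_i:
  assumes "t \<in> ring_units"
  shows "continuous_map (unit_top G) (gtop \<Sigma>) (\<lambda>x. i (x, t))"
proof -
  have "continuous_map (unit_top G) (prod_topology (unit_top G) (discrete_topology ring_units))
      (\<lambda>x. (x, t))"
    using assms by (intro continuous_map_pairedI) auto
  moreover have "continuous_map (prod_topology (unit_top G) (discrete_topology ring_units))
      (gtop \<Sigma>) i"
    using hom_i by (simp add: continuous_groupoid_hom_def unit_trivial_bundle)
  ultimately have "continuous_map (unit_top G) (gtop \<Sigma>) (i \<circ> (\<lambda>x. (x, t)))"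
    by (rule continuous_map_compose)
  then show ?thesis by (simp add: o_def)
qed

lemma continuous_act_compose:
  assumes "continuous_map X (gtop \<Sigma>) P" "t \<in> ring_units"
  shows "continuous_map X (gtop \<Sigma>) (\<lambda>x. act t (P x))"
proof -
  have P: "P x \<in> arrows \<Sigma>" if "x \<in> topspace X" for x
    using assms(1) that by (auto simp: continuous_map_def arrows_def)
  have "continuous_map X (gtop G) (\<lambda>x. rng G (q (P x)))"
    using continuous_map_compose[OF assms(1)
        continuous_map_compose[OF continuous_q G.continuous_rng]] by (simp add: o_def)
  then have "continuous_map X (unit_top G) (\<lambda>x. rng G (q (P x)))"
    using P by (auto simp: unit_top_def continuous_map_in_subtopology rng_q_unit)
  from continuous_map_compose[OF this continuous_i[OF assms(2)]]
  have "continuous_map X (gtop \<Sigma>) (\<lambda>x. i (rng G (q (P x)), t))" by (simp add: o_def)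
  then have "continuous_map X (gtop \<Sigma>) (\<lambda>x. gmult \<Sigma> (i (rng G (q (P x)), t)) (P x))"
    using assms P i_composable by (intro \<Sigma>.continuous_gmult_compose) auto
  then show ?thesis
    by (rule continuous_map_eq) (simp add: act_eq P)
qed

text \<open>A continuous section of $q$ is an open map: where the source map of $\Sigma$ is injective, an
  arrow $\sigma$ and the value of the section at $q(\sigma)$, which have the same source, agree.\<close>

lemma open_section_image:
  assumes B: "openin (gtop G) B" and P: "continuous_map (subtopology (gtop G) B) (gtop \<Sigma>) P"
    and qP: "\<And>\<beta>. \<beta> \<in> B \<Longrightarrow> q (P \<beta>) = \<beta>"
  shows "openin (gtop \<Sigma>) (P ` B)"
proof (subst openin_subopen, intro ballI)
  fix \<sigma> assume "\<sigma> \<in> P ` B"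
  then obtain \<beta> where \<beta>: "\<beta> \<in> B" "\<sigma> = P \<beta>" by blast
  have BG: "B \<subseteq> arrows G" using openin_subset[OF B] by (simp add: arrows_def)
  have PB: "P \<beta> \<in> arrows \<Sigma>" if "\<beta> \<in> B" for \<beta>
    using P that BG by (auto simp: continuous_map_def arrows_def Pi_iff subset_iff)
  obtain U where U: "openin (gtop \<Sigma>) U" "P \<beta> \<in> U" "inj_on (src \<Sigma>) U"
    using \<Sigma>.src_locally_injective PB \<beta> by metis
  define B' where "B' = {\<beta> \<in> B. P \<beta> \<in> U}"
  have "openin (subtopology (gtop G) B) {x \<in> topspace (subtopology (gtop G) B). P x \<in> U}"
    using openin_continuous_map_preimage[OF P U(1)] .
  moreover have "{x \<in> topspace (subtopology (gtop G) B). P x \<in> U} = B'"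
    using BG by (auto simp: B'_def arrows_def)
  ultimately have B': "openin (gtop G) B'"
    using openin_trans_full[OF _ B] by simp
  define V where "V = U \<inter> {\<tau> \<in> topspace (gtop \<Sigma>). q \<tau> \<in> B'}"
  have "openin (gtop \<Sigma>) V"
    unfolding V_def using openin_continuous_map_preimage[OF continuous_q B'] U(1) by blast
  moreover have "\<sigma> \<in> V"
    using U(2) \<beta> PB qP by (auto simp: V_def B'_def arrows_def)
  moreover have "V \<subseteq> P ` B"
  proof
    fix \<tau> assume "\<tau> \<in> V"
    then have \<tau>: "\<tau> \<in> U" "\<tau> \<in> arrows \<Sigma>" "q \<tau> \<in> B" "P (q \<tau>) \<in> U"
      by (auto simp: V_def B'_def arrows_def)
    have "src \<Sigma> (P (q \<tau>)) = src \<Sigma> \<tau>" using \<tau> PB qP by (simp add: src_eq_i)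
    then have "P (q \<tau>) = \<tau>" using U(3) \<tau> by (meson inj_onD)
    then show "\<tau> \<in> P ` B" using \<tau> by (metis imageI)
  qed
  ultimately show "\<exists>T. openin (gtop \<Sigma>) T \<and> \<sigma> \<in> T \<and> T \<subseteq> P ` B" by blast
qed

end

section \<open>Equivariant locally constant functions\<close>

context discrete_twist
begin

abbreviation algebra :: "('b \<Rightarrow> 'r) set" where "algebra \<equiv> twisted_steinberg G \<Sigma> i q"

text \<open>The conditions on an element of the algebra other than the compactness of its support. For a
  function built from given ones, compactness is obtained from them (see \<open>algebraI\<close> below).\<close>

definition equivariant_locally_constant :: "('b \<Rightarrow> 'r) \<Rightarrow> bool" where
  "equivariant_locally_constant f \<longleftrightarrow> (\<forall>\<sigma>. \<sigma> \<notin> arrows \<Sigma> \<longrightarrow> f \<sigma> = 0) \<and>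
     (\<forall>\<sigma>\<in>arrows \<Sigma>. \<exists>U. openin (gtop \<Sigma>) U \<and> \<sigma> \<in> U \<and> (\<forall>\<tau>\<in>U. f \<tau> = f \<sigma>)) \<and>
     (\<forall>t\<in>ring_units. \<forall>\<sigma>\<in>arrows \<Sigma>. f (act t \<sigma>) = unit_inverse t * f \<sigma>)"

lemma equivariant_locally_constantD:
  assumes "equivariant_locally_constant f"
  shows "\<sigma> \<notin> arrows \<Sigma> \<Longrightarrow> f \<sigma> = 0"
    and "\<sigma> \<in> arrows \<Sigma> \<Longrightarrow> \<exists>U. openin (gtop \<Sigma>) U \<and> \<sigma> \<in> U \<and> (\<forall>\<tau>\<in>U. f \<tau> = f \<sigma>)"
    and "t \<in> ring_units \<Longrightarrow> \<sigma> \<in> arrows \<Sigma> \<Longrightarrow> f (act t \<sigma>) = unit_inverse t * f \<sigma>"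
  using assms unfolding equivariant_locally_constant_def by blast+

lemma algebra_iff:
  "f \<in> algebra \<longleftrightarrow>
     equivariant_locally_constant f \<and> compactin (gtop G) (supp\<^sub>G \<Sigma> q f)"
  by (simp add: twisted_steinberg_def equivariant_locally_constant_def)

lemma algebraD:
  assumes "f \<in> algebra"
  shows "equivariant_locally_constant f" "compactin (gtop G) (supp\<^sub>G \<Sigma> q f)"
  using assms by (simp_all add: algebra_iff)

lemmas algebra_outside = equivariant_locally_constantD(1)[OF algebraD(1)]
lemmas algebra_locally_constant = equivariant_locally_constantD(2)[OF algebraD(1)]
lemmas algebra_act = equivariant_locally_constantD(3)[OF algebraD(1)]

lemma mem_supp\<^sub>G_iff:
  assumes "equivariant_locally_constant f" "\<sigma> \<in> arrows \<Sigma>"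
  shows "q \<sigma> \<in> supp\<^sub>G \<Sigma> q f \<longleftrightarrow> f \<sigma> \<noteq> 0"
proof
  assume "q \<sigma> \<in> supp\<^sub>G \<Sigma> q f"
  then obtain \<tau> where \<tau>: "\<tau> \<in> arrows \<Sigma>" "f \<tau> \<noteq> 0" "q \<sigma> = q \<tau>"
    by (auto simp: supp\<^sub>G_def supp_def)
  then obtain t where "t \<in> ring_units" "\<sigma> = act t \<tau>" using same_q_imp_act[OF assms(2) \<tau>(1,3)] by metis
  moreover from this have "f (act t \<tau>) = unit_inverse t * f \<tau>"
    using \<tau>(1) equivariant_locally_constantD(3)[OF assms(1)] by blast
  ultimately show "f \<sigma> \<noteq> 0"
    using \<tau>(2) unit_mult_eq_0_iff[OF unit_inverse_units] by metis
next
  assume "f \<sigma> \<noteq> 0"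
  then show "q \<sigma> \<in> supp\<^sub>G \<Sigma> q f" using assms(2) unfolding supp\<^sub>G_def supp_def by blast
qed

lemma supp\<^sub>G_subset: "supp\<^sub>G \<Sigma> q f \<subseteq> arrows G"
  using q_closed by (auto simp: supp\<^sub>G_def supp_def)

text \<open>Along a continuous local section $P$ of $q$ the function $f \circ P$ is locally constant, and
  by equivariance it vanishes exactly off $\mathrm{supp}_G(f)$. So membership in
  $\mathrm{supp}_G(f)$ is locally constant on $G$.\<close>

lemma supp\<^sub>G_clopen:
  assumes "equivariant_locally_constant f"
  shows "openin (gtop G) (supp\<^sub>G \<Sigma> q f)" "closedin (gtop G) (supp\<^sub>G \<Sigma> q f)"
proof -
  have *: "\<exists>W. openin (gtop G) W \<and> \<alpha> \<in> W \<and> (\<forall>\<beta>\<in>W. \<beta> \<in> supp\<^sub>G \<Sigma> q f \<longleftrightarrow> \<alpha> \<in> supp\<^sub>G \<Sigma> q f)"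
    if \<alpha>: "\<alpha> \<in> arrows G" for \<alpha>
  proof -
    obtain B P where B: "open_bisection G B" "\<alpha> \<in> B"
      "continuous_map (subtopology (gtop G) B) (gtop \<Sigma>) P" "\<forall>\<beta>\<in>B. q (P \<beta>) = \<beta>"
      using DT2[OF \<alpha>] by metis
    have oB: "openin (gtop G) B" using B(1) by (simp add: open_bisection_def)
    then have ts: "topspace (subtopology (gtop G) B) = B"
      using openin_subset[OF oB] by (simp add: Int_absorb1)
    have PB: "P \<beta> \<in> arrows \<Sigma>" if "\<beta> \<in> B" for \<beta>
      using B(3) that ts by (auto simp: continuous_map_def arrows_def)
    obtain U where U: "openin (gtop \<Sigma>) U" "P \<alpha> \<in> U" "\<forall>\<tau>\<in>U. f \<tau> = f (P \<alpha>)"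
      using equivariant_locally_constantD(2)[OF assms PB[OF B(2)]] by blast
    have "openin (gtop G) {\<beta> \<in> B. P \<beta> \<in> U}"
      using openin_trans_full[OF openin_continuous_map_preimage[OF B(3) U(1)] oB] unfolding ts .
    moreover have "\<beta> \<in> supp\<^sub>G \<Sigma> q f \<longleftrightarrow> \<alpha> \<in> supp\<^sub>G \<Sigma> q f" if "\<beta> \<in> B" "P \<beta> \<in> U" for \<beta>
      using that B U mem_supp\<^sub>G_iff[OF assms PB] by metis
    ultimately show ?thesis using B(2) U(2) by blast
  qed
  show "openin (gtop G) (supp\<^sub>G \<Sigma> q f)"
  proof (subst openin_subopen, intro ballI)
    fix \<alpha> assume \<alpha>: "\<alpha> \<in> supp\<^sub>G \<Sigma> q f"
    then obtain W where "openin (gtop G) W" "\<alpha> \<in> W"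
      "\<forall>\<beta>\<in>W. \<beta> \<in> supp\<^sub>G \<Sigma> q f \<longleftrightarrow> \<alpha> \<in> supp\<^sub>G \<Sigma> q f" using * supp\<^sub>G_subset by blast
    with \<alpha> show "\<exists>T. openin (gtop G) T \<and> \<alpha> \<in> T \<and> T \<subseteq> supp\<^sub>G \<Sigma> q f" by blast
  qed
  have "openin (gtop G) (arrows G - supp\<^sub>G \<Sigma> q f)"
  proof (subst openin_subopen, intro ballI)
    fix \<alpha> assume "\<alpha> \<in> arrows G - supp\<^sub>G \<Sigma> q f"
    moreover from this obtain W where W: "openin (gtop G) W" "\<alpha> \<in> W"
      "\<forall>\<beta>\<in>W. \<beta> \<in> supp\<^sub>G \<Sigma> q f \<longleftrightarrow> \<alpha> \<in> supp\<^sub>G \<Sigma> q f" using * by blast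
    moreover have "W \<subseteq> arrows G" using openin_subset[OF W(1)] by (simp add: arrows_def)
    ultimately show "\<exists>T. openin (gtop G) T \<and> \<alpha> \<in> T \<and> T \<subseteq> arrows G - supp\<^sub>G \<Sigma> q f" by blast
  qed
  then show "closedin (gtop G) (supp\<^sub>G \<Sigma> q f)"
    using supp\<^sub>G_subset by (simp add: closedin_def arrows_def)
qed

text \<open>Since the support is always closed, it is compact as soon as it lies in a compact set.\<close>

lemma algebraI:
  assumes "equivariant_locally_constant f" "supp\<^sub>G \<Sigma> q f \<subseteq> K" "compactin (gtop G) K"
  shows "f \<in> algebra"
  using closed_compactin[OF assms(3,2) supp\<^sub>G_clopen(2)] assms(1) by (simp add: algebra_iff)

lemma zero_in_algebra: "(\<lambda>_. 0) \<in> algebra"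
proof (rule algebraI)
  show "equivariant_locally_constant (\<lambda>_. 0)"
    unfolding equivariant_locally_constant_def arrows_def using openin_topspace by auto
  show "supp\<^sub>G \<Sigma> q (\<lambda>_. 0 :: 'r) \<subseteq> {}" by (simp add: supp\<^sub>G_def supp_def)
qed simp

lemma diff_in_algebra:
  assumes "f \<in> algebra" "g \<in> algebra"
  shows "(\<lambda>\<sigma>. f \<sigma> - g \<sigma>) \<in> algebra"
proof (rule algebraI)
  show "compactin (gtop G) (supp\<^sub>G \<Sigma> q f \<union> supp\<^sub>G \<Sigma> q g)"
    using assms by (simp add: algebra_iff compactin_Un)
  show "supp\<^sub>G \<Sigma> q (\<lambda>\<sigma>. f \<sigma> - g \<sigma>) \<subseteq> supp\<^sub>G \<Sigma> q f \<union> supp\<^sub>G \<Sigma> q g"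
  proof -
    have "supp \<Sigma> (\<lambda>\<sigma>. f \<sigma> - g \<sigma>) \<subseteq> supp \<Sigma> f \<union> supp \<Sigma> g" by (auto simp: supp_def)
    then show ?thesis by (auto simp: supp\<^sub>G_def)
  qed
  show "equivariant_locally_constant (\<lambda>\<sigma>. f \<sigma> - g \<sigma>)"
    unfolding equivariant_locally_constant_def
  proof (intro conjI ballI allI impI)
    fix \<sigma> assume \<sigma>: "\<sigma> \<in> arrows \<Sigma>"
    obtain U where U: "openin (gtop \<Sigma>) U" "\<sigma> \<in> U" "\<forall>\<tau>\<in>U. f \<tau> = f \<sigma>"
      using algebra_locally_constant[OF assms(1) \<sigma>] by blast
    obtain V where V: "openin (gtop \<Sigma>) V" "\<sigma> \<in> V" "\<forall>\<tau>\<in>V. g \<tau> = g \<sigma>"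
      using algebra_locally_constant[OF assms(2) \<sigma>] by blast
    show "\<exists>U. openin (gtop \<Sigma>) U \<and> \<sigma> \<in> U \<and> (\<forall>\<tau>\<in>U. f \<tau> - g \<tau> = f \<sigma> - g \<sigma>)"
    proof (intro exI conjI ballI)
      show "openin (gtop \<Sigma>) (U \<inter> V)" "\<sigma> \<in> U \<inter> V" using U(1,2) V(1,2) by auto
      show "f \<tau> - g \<tau> = f \<sigma> - g \<sigma>" if "\<tau> \<in> U \<inter> V" for \<tau>
        using U(3)[rule_format, of \<tau>] V(3)[rule_format, of \<tau>] that by simp
    qed
  next
    fix t :: 'r and \<sigma> assume t: "t \<in> ring_units" and \<sigma>: "\<sigma> \<in> arrows \<Sigma>"
    note algebra_act[OF assms(1) t \<sigma>] algebra_act[OF assms(2) t \<sigma>]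
    then show "f (act t \<sigma>) - g (act t \<sigma>) = unit_inverse t * (f \<sigma> - g \<sigma>)"
      by (simp only: right_diff_distrib)
  next
    fix \<sigma> assume "\<sigma> \<notin> arrows \<Sigma>"
    then show "f \<sigma> - g \<sigma> = 0" using assms by (simp add: algebra_outside)
  qed
qed

definition cut :: "'a set \<Rightarrow> ('b \<Rightarrow> 'r) \<Rightarrow> 'b \<Rightarrow> 'r" where
  "cut C f = (\<lambda>\<sigma>. if q \<sigma> \<in> C then f \<sigma> else 0)"

lemma open_q_vimage: "openin (gtop G) C \<Longrightarrow> openin (gtop \<Sigma>) {\<sigma> \<in> arrows \<Sigma>. q \<sigma> \<in> C}"
  using openin_continuous_map_preimage[OF continuous_q] by (simp add: arrows_def)

lemma supp\<^sub>G_cut: "supp\<^sub>G \<Sigma> q (cut C f) = supp\<^sub>G \<Sigma> q f \<inter> C"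
  by (auto simp: supp\<^sub>G_def supp_def cut_def)

lemma cut_in_algebra:
  assumes "f \<in> algebra" "openin (gtop G) C" "closedin (gtop G) C"
  shows "cut C f \<in> algebra"
proof (rule algebraI)
  show "compactin (gtop G) (supp\<^sub>G \<Sigma> q f)"
    using assms by (simp add: algebra_iff)
  show "supp\<^sub>G \<Sigma> q (cut C f) \<subseteq> supp\<^sub>G \<Sigma> q f" by (simp add: supp\<^sub>G_cut)
  show "equivariant_locally_constant (cut C f)"
    unfolding equivariant_locally_constant_def
  proof (intro conjI ballI allI impI)
    fix \<sigma> assume \<sigma>: "\<sigma> \<in> arrows \<Sigma>"
    obtain U where U: "openin (gtop \<Sigma>) U" "\<sigma> \<in> U" "\<forall>\<tau>\<in>U. f \<tau> = f \<sigma>"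
      using algebra_locally_constant[OF assms(1) \<sigma>] by blast
    have "openin (gtop G) (topspace (gtop G) - C)" using assms(3) by blast
    note op = open_q_vimage[OF assms(2)] open_q_vimage[OF this]
    show "\<exists>U. openin (gtop \<Sigma>) U \<and> \<sigma> \<in> U \<and> (\<forall>\<tau>\<in>U. cut C f \<tau> = cut C f \<sigma>)"
    proof (cases "q \<sigma> \<in> C")
      case True
      show ?thesis
      proof (intro exI conjI ballI)
        show "openin (gtop \<Sigma>) (U \<inter> {\<sigma> \<in> arrows \<Sigma>. q \<sigma> \<in> C})" using U(1) op(1) by blast
        show "\<sigma> \<in> U \<inter> {\<sigma> \<in> arrows \<Sigma>. q \<sigma> \<in> C}" using U(2) \<sigma> True by blast
        show "cut C f \<tau> = cut C f \<sigma>" if "\<tau> \<in> U \<inter> {\<sigma> \<in> arrows \<Sigma>. q \<sigma> \<in> C}" for \<tau>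
          using U(3)[rule_format, of \<tau>] that True by (simp add: cut_def)
      qed
    next
      case False
      then have "\<sigma> \<in> {\<sigma> \<in> arrows \<Sigma>. q \<sigma> \<in> topspace (gtop G) - C}"
        using \<sigma> q_closed by (simp add: arrows_def)
      with False op(2) show ?thesis
        by (intro exI[of _ "{\<sigma> \<in> arrows \<Sigma>. q \<sigma> \<in> topspace (gtop G) - C}"]) (auto simp: cut_def)
    qed
  next
    fix t :: 'r and \<sigma> assume t: "t \<in> ring_units" and \<sigma>: "\<sigma> \<in> arrows \<Sigma>"
    show "cut C f (act t \<sigma>) = unit_inverse t * cut C f \<sigma>"
      using algebra_act[OF assms(1) t \<sigma>] by (simp add: cut_def act_closed(2)[OF \<sigma> t])
  next
    fix \<sigma> assume "\<sigma> \<notin> arrows \<Sigma>"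
    then show "cut C f \<sigma> = 0" using assms(1) by (simp add: cut_def algebra_outside)
  qed
qed

section \<open>Multiplication by functions attached to sections\<close>

definition compact_section :: "'a set \<Rightarrow> ('a \<Rightarrow> 'b) \<Rightarrow> bool" where
  "compact_section B P \<longleftrightarrow> openin (gtop G) B \<and> compactin (gtop G) B \<and>
     continuous_map (subtopology (gtop G) B) (gtop \<Sigma>) P \<and> (\<forall>\<beta>\<in>B. q (P \<beta>) = \<beta>)"

text \<open>For a section $P$ on a compact open $B$, this is the equivariant function supported on
  $q^{-1}(B)$ that takes the value $1$ on $P(B)$: its value at $t \cdot P(\beta)$ is $t^{-1}$. For a
  set $B$ of units and $P(x) = i(x, 1)$ it plays the role of the characteristic function of $B$.\<close>

definition section_fun :: "'a set \<Rightarrow> ('a \<Rightarrow> 'b) \<Rightarrow> 'b \<Rightarrow> 'r" where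
  "section_fun B P \<sigma> = (if \<sigma> \<in> arrows \<Sigma> \<and> q \<sigma> \<in> B
     then unit_inverse (THE t. t \<in> ring_units \<and> \<sigma> = act t (P (q \<sigma>))) else 0)"

lemma section_arrows:
  assumes "compact_section B P" "\<beta> \<in> B"
  shows "P \<beta> \<in> arrows \<Sigma>" "q (P \<beta>) = \<beta>" "\<beta> \<in> arrows G"
proof -
  show "\<beta> \<in> arrows G"
    using assms by (auto simp: compact_section_def arrows_def dest: openin_subset)
  then show "P \<beta> \<in> arrows \<Sigma>"
    using assms by (auto simp: compact_section_def arrows_def continuous_map_def)
  show "q (P \<beta>) = \<beta>" using assms by (simp add: compact_section_def)
qed

lemma section_fun_act:
  assumes "compact_section B P" "\<beta> \<in> B" "t \<in> ring_units"
  shows "section_fun B P (act t (P \<beta>)) = unit_inverse t"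
proof -
  note P = section_arrows[OF assms(1,2)]
  have "(THE u. u \<in> ring_units \<and> act t (P \<beta>) = act u (P \<beta>)) = t"
    using act_inj[OF P(1)] assms(3) by (intro the_equality) auto
  then show ?thesis using P assms act_closed[OF P(1) assms(3)] by (simp add: section_fun_def)
qed

lemma section_funE:
  assumes "compact_section B P" "\<sigma> \<in> arrows \<Sigma>" "q \<sigma> \<in> B"
  obtains t where "t \<in> ring_units" "\<sigma> = act t (P (q \<sigma>))" "section_fun B P \<sigma> = unit_inverse t"
proof -
  note P = section_arrows[OF assms(1,3)]
  obtain t where "t \<in> ring_units" "\<sigma> = act t (P (q \<sigma>))"
    using same_q_imp_act[OF assms(2) P(1)] P(2) by metis
  with that section_fun_act[OF assms(1,3)] show thesis by metis
qed

text \<open>The sets on which the function is constant are the images of the sections $t \cdot P$, which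
  are open, and the complement of $q^{-1}(B)$, which is open because $B$ is compact.\<close>

lemma section_fun_in_algebra:
  assumes BP: "compact_section B P"
  shows "section_fun B P \<in> algebra"
proof (rule algebraI)
  have B: "openin (gtop G) B" "compactin (gtop G) B"
     "continuous_map (subtopology (gtop G) B) (gtop \<Sigma>) P"
    using BP by (auto simp: compact_section_def)
  show "compactin (gtop G) B" by fact
  show "supp\<^sub>G \<Sigma> q (section_fun B P) \<subseteq> B"
    by (auto simp: supp\<^sub>G_def supp_def section_fun_def split: if_splits)
  show "equivariant_locally_constant (section_fun B P)"
    unfolding equivariant_locally_constant_def
  proof (intro conjI ballI allI impI)
    fix \<sigma> assume \<sigma>: "\<sigma> \<in> arrows \<Sigma>"
    show "\<exists>U. openin (gtop \<Sigma>) U \<and> \<sigma> \<in> U \<and> (\<forall>\<tau>\<in>U. section_fun B P \<tau> = section_fun B P \<sigma>)"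
    proof (cases "q \<sigma> \<in> B")
      case True
      then obtain t where t: "t \<in> ring_units" "\<sigma> = act t (P (q \<sigma>))"
          "section_fun B P \<sigma> = unit_inverse t"
        using section_funE[OF BP \<sigma>] by blast
      have "openin (gtop \<Sigma>) ((\<lambda>\<beta>. act t (P \<beta>)) ` B)"
        using B(1) continuous_act_compose[OF B(3) t(1)]
        by (rule open_section_image) (simp add: act_closed section_arrows[OF BP] t(1))
      moreover have "\<sigma> \<in> (\<lambda>\<beta>. act t (P \<beta>)) ` B" using True t(2) by blast
      ultimately show ?thesis
        using section_fun_act[OF BP _ t(1)] t(3) by (intro exI[of _ "(\<lambda>\<beta>. act t (P \<beta>)) ` B"]) auto
    next
      case False
      have "closedin (gtop G) B" using compactin_imp_closedin[OF Hausdorff_G B(2)] .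
      then have "openin (gtop G) (topspace (gtop G) - B)" by blast
      note op = open_q_vimage[OF this]
      have "\<sigma> \<in> {\<sigma> \<in> arrows \<Sigma>. q \<sigma> \<in> topspace (gtop G) - B}"
        using False \<sigma> q_closed by (simp add: arrows_def)
      with False op show ?thesis
        by (intro exI[of _ "{\<sigma> \<in> arrows \<Sigma>. q \<sigma> \<in> topspace (gtop G) - B}"])
           (auto simp: section_fun_def)
    qed
  next
    fix t :: 'r and \<sigma> assume t: "t \<in> ring_units" and \<sigma>: "\<sigma> \<in> arrows \<Sigma>"
    show "section_fun B P (act t \<sigma>) = unit_inverse t * section_fun B P \<sigma>"
    proof (cases "q \<sigma> \<in> B")
      case True
      then obtain u where u: "u \<in> ring_units" "\<sigma> = act u (P (q \<sigma>))"
          "section_fun B P \<sigma> = unit_inverse u"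
        using section_funE[OF BP \<sigma>] by blast
      have "act t \<sigma> = act (t * u) (P (q \<sigma>))"
        using u(1,2) t act_act[OF section_arrows(1)[OF BP True]] by metis
      then show ?thesis
        using section_fun_act[OF BP True mult_ring_units[OF t u(1)]] u(3) unit_inverse_mult[OF t u(1)]
        by simp
    qed (simp add: section_fun_def act_closed \<sigma> t)
  qed (simp add: section_fun_def)
qed

lemma section_inv_into:
  assumes "\<alpha> \<in> arrows G"
  shows "inv_into (arrows \<Sigma>) q \<alpha> \<in> arrows \<Sigma>" "q (inv_into (arrows \<Sigma>) q \<alpha>) = \<alpha>"
  using assms DT1_surj by (auto simp: inv_into_into f_inv_into_f)

text \<open>At most one term of the convolution survives, because $r$ is injective on $B$; the
  contravariance of $f$ absorbs the unit by which the value of the chosen section differs from that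
  of $P$.\<close>

lemma section_fun_conv:
  assumes BP: "compact_section B P" and inj: "inj_on (rng G) B"
    and f: "equivariant_locally_constant f" and \<sigma>: "\<sigma> \<in> arrows \<Sigma>"
    and \<beta>: "\<beta> \<in> B" "rng G \<beta> = rng G (q \<sigma>)"
  shows "twisted_conv G \<Sigma> q (section_fun B P) f \<sigma> = f (gmult \<Sigma> (ginv \<Sigma> (P \<beta>)) \<sigma>)"
proof -
  let ?n = "section_fun B P" and ?S = "inv_into (arrows \<Sigma>) q"
  let ?F = "\<lambda>\<alpha>. ?n (?S \<alpha>) * f (gmult \<Sigma> (ginv \<Sigma> (?S \<alpha>)) \<sigma>)"
  let ?I = "{\<alpha>. \<alpha> \<in> supp\<^sub>G \<Sigma> q ?n \<and> rng G \<alpha> = rng G (q \<sigma>)}"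
  note P = section_arrows[OF BP \<beta>(1)]
  note S = section_inv_into[OF P(3)]
  have elc: "equivariant_locally_constant ?n" using section_fun_in_algebra[OF BP] algebra_iff by blast
  obtain t where t: "t \<in> ring_units" "?S \<beta> = act t (P \<beta>)" "?n (?S \<beta>) = unit_inverse t"
    using section_funE[OF BP S(1)] S(2) \<beta>(1) by metis
  have "?I \<subseteq> {\<beta>}"
  proof
    fix \<alpha> assume \<alpha>: "\<alpha> \<in> ?I"
    then have "\<alpha> \<in> B" by (auto simp: supp\<^sub>G_def supp_def section_fun_def split: if_splits)
    then have "\<alpha> = \<beta>" using inj_onD[OF inj, of \<alpha> \<beta>] \<alpha> \<beta> by simp
    then show "\<alpha> \<in> {\<beta>}" by simp
  qed
  moreover have "?F \<alpha> = 0" if "\<alpha> \<in> {\<beta>} - ?I" for \<alpha>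
  proof -
    have "\<beta> \<notin> supp\<^sub>G \<Sigma> q ?n" using that \<beta>(2) by blast
    then have "?n (?S \<beta>) = 0" using mem_supp\<^sub>G_iff[OF elc S(1)] S(2) by metis
    then show ?thesis using that by simp
  qed
  ultimately have "sum ?F ?I = sum ?F {\<beta>}"
    by (intro sum.mono_neutral_left) auto
  also have "\<dots> = unit_inverse t * f (gmult \<Sigma> (ginv \<Sigma> (act t (P \<beta>))) \<sigma>)"
    using t by simp
  also have "gmult \<Sigma> (ginv \<Sigma> (act t (P \<beta>))) \<sigma> = act (unit_inverse t) (gmult \<Sigma> (ginv \<Sigma> (P \<beta>)) \<sigma>)"
  proof -
    have "(ginv \<Sigma> (P \<beta>), \<sigma>) \<in> composable \<Sigma>"
      using P \<sigma> \<beta>(2) by (simp add: composable_\<Sigma>_iff \<Sigma>.ginv_closed q_ginv G.src_ginv)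
    then show ?thesis
      using act_ginv[OF P(1) t(1)] act_gmult_left(2) unit_inverse_units[OF t(1)] by simp
  qed
  also have "f \<dots> = t * f (gmult \<Sigma> (ginv \<Sigma> (P \<beta>)) \<sigma>)"
  proof -
    have "(ginv \<Sigma> (P \<beta>), \<sigma>) \<in> composable \<Sigma>"
      using P \<sigma> \<beta>(2) by (simp add: composable_\<Sigma>_iff \<Sigma>.ginv_closed q_ginv G.src_ginv)
    then show ?thesis
      using equivariant_locally_constantD(3)[OF f unit_inverse_units[OF t(1)]]
        \<Sigma>.gmult_closed unit_inverse_inverse[OF t(1)] by simp
  qed
  also have "unit_inverse t * \<dots> = f (gmult \<Sigma> (ginv \<Sigma> (P \<beta>)) \<sigma>)"
    using unit_inverse_right[OF t(1)] by (simp add: mult.commute[of _ t] flip: mult.assoc)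
  finally show ?thesis using \<sigma> by (simp add: twisted_conv_def Let_def)
qed

lemma section_fun_conv_outside:
  assumes "\<nexists>\<beta>. \<beta> \<in> B \<and> rng G \<beta> = rng G (q \<sigma>)"
  shows "twisted_conv G \<Sigma> q (section_fun B P) f \<sigma> = 0"
proof -
  have "{\<alpha>. \<alpha> \<in> supp\<^sub>G \<Sigma> q (section_fun B P) \<and> rng G \<alpha> = rng G (q \<sigma>)} = {}"
    using assms by (auto simp: supp\<^sub>G_def supp_def section_fun_def split: if_splits)
  then show ?thesis unfolding twisted_conv_def Let_def by (simp only: sum.empty if_cancel)
qed

lemma supp\<^sub>G_section_fun_conv:
  assumes BP: "compact_section B P" and inj: "inj_on (rng G) B"
    and f: "equivariant_locally_constant f"
  shows "supp\<^sub>G \<Sigma> q (twisted_conv G \<Sigma> q (section_fun B P) f) =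
    {\<delta> \<in> arrows G. \<exists>\<beta>\<in>B. rng G \<beta> = rng G \<delta> \<and> gmult G (ginv G \<beta>) \<delta> \<in> supp\<^sub>G \<Sigma> q f}"
    (is "?L = ?R")
proof -
  let ?h = "twisted_conv G \<Sigma> q (section_fun B P) f"
  have key: "?h \<sigma> = f (gmult \<Sigma> (ginv \<Sigma> (P \<beta>)) \<sigma>) \<and>
      (?h \<sigma> \<noteq> 0 \<longleftrightarrow> gmult G (ginv G \<beta>) (q \<sigma>) \<in> supp\<^sub>G \<Sigma> q f)"
    if "\<sigma> \<in> arrows \<Sigma>" "\<beta> \<in> B" "rng G \<beta> = rng G (q \<sigma>)" for \<sigma> \<beta>
  proof -
    note P = section_arrows[OF BP that(2)]
    have c: "(ginv \<Sigma> (P \<beta>), \<sigma>) \<in> composable \<Sigma>"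
      using P that by (simp add: composable_\<Sigma>_iff \<Sigma>.ginv_closed q_ginv G.src_ginv)
    show ?thesis
      using section_fun_conv[OF BP inj f that] mem_supp\<^sub>G_iff[OF f \<Sigma>.gmult_closed[OF c]]
        q_gmult(2)[OF c] P by (simp add: q_ginv)
  qed
  show ?thesis
  proof
    show "?L \<subseteq> ?R"
    proof
      fix \<delta> assume "\<delta> \<in> ?L"
      then obtain \<sigma> where \<sigma>: "\<sigma> \<in> arrows \<Sigma>" "?h \<sigma> \<noteq> 0" "\<delta> = q \<sigma>"
        by (auto simp: supp\<^sub>G_def supp_def)
      then obtain \<beta> where "\<beta> \<in> B" "rng G \<beta> = rng G (q \<sigma>)"
        using section_fun_conv_outside by blast
      then show "\<delta> \<in> ?R" using key \<sigma> q_closed by blast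
    qed
    show "?R \<subseteq> ?L"
    proof
      fix \<delta> assume "\<delta> \<in> ?R"
      then obtain \<beta> where "\<delta> \<in> arrows G" "\<beta> \<in> B" "rng G \<beta> = rng G \<delta>"
          "gmult G (ginv G \<beta>) \<delta> \<in> supp\<^sub>G \<Sigma> q f" by blast
      moreover obtain \<sigma> where "\<sigma> \<in> arrows \<Sigma>" "\<delta> = q \<sigma>"
        using DT1_surj \<open>\<delta> \<in> arrows G\<close> by blast
      ultimately show "\<delta> \<in> ?L" using key[of \<sigma> \<beta>] by (auto simp: supp\<^sub>G_def supp_def)
    qed
  qed
qed

text \<open>On the clopen set of those $\sigma$ whose range lies in $r(B)$, the product is $f$ composed with
  the continuous map $\sigma \mapsto P(\beta)^{-1}\sigma$, where $\beta \in B$ is determined by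
  $r(\beta) = r(q(\sigma))$; elsewhere it is zero. Its support lies in $B \cdot \mathrm{supp}_G(f)$,
  the image of a compact set of composable pairs.\<close>

lemma section_fun_conv_in_algebra:
  assumes BP: "compact_section B P" and bis: "open_bisection G B" and f: "f \<in> algebra"
  shows "twisted_conv G \<Sigma> q (section_fun B P) f \<in> algebra"
proof (rule algebraI)
  let ?h = "twisted_conv G \<Sigma> q (section_fun B P) f"
  have B: "openin (gtop G) B" "compactin (gtop G) B"
     "continuous_map (subtopology (gtop G) B) (gtop \<Sigma>) P"
    using BP by (auto simp: compact_section_def)
  have inj: "inj_on (rng G) B" using G.inj_rng_bisection[OF bis] .
  have f': "equivariant_locally_constant f" "compactin (gtop G) (supp\<^sub>G \<Sigma> q f)"
    using f by (auto simp: algebra_iff)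
  note P = section_arrows[OF BP]
  let ?C = "(B \<times> supp\<^sub>G \<Sigma> q f) \<inter> composable G"
  have "compactin (prod_topology (gtop G) (gtop G)) (B \<times> supp\<^sub>G \<Sigma> q f)"
    using B(2) f'(2) by (simp add: compactin_Times)
  then have "compactin (prod_topology (gtop G) (gtop G)) ?C"
    using G.closed_composable[OF Hausdorff_G] by (rule compact_Int_closedin)
  then have "compactin (subtopology (prod_topology (gtop G) (gtop G)) (composable G)) ?C"
    by (simp add: compactin_subtopology)
  from image_compactin[OF this G.continuous_gmult]
  show "compactin (gtop G) ((\<lambda>(\<alpha>, \<beta>). gmult G \<alpha> \<beta>) ` ?C)" .
  show "supp\<^sub>G \<Sigma> q ?h \<subseteq> (\<lambda>(\<alpha>, \<beta>). gmult G \<alpha> \<beta>) ` ?C"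
  proof
    fix \<delta> assume "\<delta> \<in> supp\<^sub>G \<Sigma> q ?h"
    then obtain \<beta> where \<beta>: "\<delta> \<in> arrows G" "\<beta> \<in> B" "rng G \<beta> = rng G \<delta>"
        "gmult G (ginv G \<beta>) \<delta> \<in> supp\<^sub>G \<Sigma> q f"
      unfolding supp\<^sub>G_section_fun_conv[OF BP inj f'(1)] by blast
    have c: "(ginv G \<beta>, \<delta>) \<in> composable G"
      using \<beta> P(3) by (simp add: G.composable_iff G.ginv_closed G.src_ginv)
    have c2: "(\<beta>, gmult G (ginv G \<beta>) \<delta>) \<in> composable G"
      using \<beta> P(3) c by (simp add: G.composable_iff G.gmult_closed G.rng_gmult G.rng_ginv)
    have "\<delta> = gmult G \<beta> (gmult G (ginv G \<beta>) \<delta>)"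
      using G.cancel_left[OF c] \<beta> P(3) by (simp add: G.ginv_ginv)
    then show "\<delta> \<in> (\<lambda>(\<alpha>, \<beta>). gmult G \<alpha> \<beta>) ` ?C"
      using c2 \<beta> by (intro image_eqI[of _ _ "(\<beta>, gmult G (ginv G \<beta>) \<delta>)"]) auto
  qed
  \<comment> \<open>\<open>W\<close> is the clopen set on which \<open>b\<close> below, sending $\sigma$ to this $\beta$, is defined.\<close>
  define W where "W = {\<sigma> \<in> arrows \<Sigma>. rng G (q \<sigma>) \<in> rng G ` B}"
  have contq: "continuous_map (gtop \<Sigma>) (gtop G) (\<lambda>\<sigma>. rng G (q \<sigma>))"
    using continuous_map_compose[OF continuous_q G.continuous_rng] by (simp add: o_def)
  have "openin (gtop G) (rng G ` B)"
    using bis G.open_unit_space openin_trans_full unfolding open_bisection_def unit_top_def by blast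
  from openin_continuous_map_preimage[OF contq this]
  have oW: "openin (gtop \<Sigma>) W" by (simp add: W_def arrows_def)
  have "closedin (gtop G) (rng G ` B)"
    using compactin_imp_closedin[OF Hausdorff_G image_compactin[OF B(2) G.continuous_rng]] .
  from closedin_continuous_map_preimage[OF contq this]
  have "closedin (gtop \<Sigma>) W" by (simp add: W_def arrows_def)
  then have oW': "openin (gtop \<Sigma>) (arrows \<Sigma> - W)" by (simp add: arrows_def openin_diff)
  have tsW: "topspace (subtopology (gtop \<Sigma>) W) = W"
    using openin_subset[OF oW] by (simp add: Int_absorb1)
  have tsB: "topspace (subtopology (gtop G) B) = B"
    using openin_subset[OF B(1)] by (simp add: Int_absorb1)
  obtain k where k: "continuous_map (subtopology (unit_top G) (rng G ` B)) (subtopology (gtop G) B) k"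
      "\<And>\<beta>. \<beta> \<in> B \<Longrightarrow> k (rng G \<beta>) = \<beta>"
    using bis tsB unfolding open_bisection_def homeomorphic_map_maps homeomorphic_maps_def by metis
  define b where "b = (\<lambda>\<sigma>. k (rng G (q \<sigma>)))"
  have b: "b \<sigma> \<in> B" "rng G (b \<sigma>) = rng G (q \<sigma>)" if "\<sigma> \<in> W" for \<sigma>
    using that k(2) by (auto simp: W_def b_def)
  have "continuous_map (subtopology (gtop \<Sigma>) W) (subtopology (unit_top G) (rng G ` B))
      (\<lambda>\<sigma>. rng G (q \<sigma>))"
    using continuous_map_from_subtopology[OF contq]
    by (auto simp: unit_top_def continuous_map_in_subtopology W_def rng_q_unit)
  from continuous_map_compose[OF continuous_map_compose[OF this k(1)] B(3)]
  have "continuous_map (subtopology (gtop \<Sigma>) W) (gtop \<Sigma>) (\<lambda>\<sigma>. P (b \<sigma>))"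
    by (simp add: o_def b_def)
  from continuous_map_compose[OF this \<Sigma>.continuous_ginv]
  have "continuous_map (subtopology (gtop \<Sigma>) W) (gtop \<Sigma>) (\<lambda>\<sigma>. ginv \<Sigma> (P (b \<sigma>)))"
    by (simp add: o_def)
  then have cont: "continuous_map (subtopology (gtop \<Sigma>) W) (gtop \<Sigma>)
      (\<lambda>\<sigma>. gmult \<Sigma> (ginv \<Sigma> (P (b \<sigma>))) \<sigma>)"
  proof (rule \<Sigma>.continuous_gmult_compose)
    show "continuous_map (subtopology (gtop \<Sigma>) W) (gtop \<Sigma>) (\<lambda>\<sigma>. \<sigma>)"
      using continuous_map_from_subtopology[OF continuous_map_id] by (simp add: id_def)
    fix \<sigma> assume "\<sigma> \<in> topspace (subtopology (gtop \<Sigma>) W)"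
    then have "\<sigma> \<in> W" using tsW by simp
    then show "(ginv \<Sigma> (P (b \<sigma>)), \<sigma>) \<in> composable \<Sigma>"
      using b P by (auto simp: composable_\<Sigma>_iff \<Sigma>.ginv_closed q_ginv G.src_ginv W_def)
  qed
  have h: "?h \<sigma> = f (gmult \<Sigma> (ginv \<Sigma> (P (b \<sigma>))) \<sigma>)" if "\<sigma> \<in> W" for \<sigma>
    using that section_fun_conv[OF BP inj f'(1) _ b[OF that]] by (simp add: W_def)
  have h0: "?h \<sigma> = 0" if "\<sigma> \<in> arrows \<Sigma> - W" for \<sigma>
  proof (rule section_fun_conv_outside)
    show "\<nexists>\<beta>. \<beta> \<in> B \<and> rng G \<beta> = rng G (q \<sigma>)"
      using that unfolding W_def by (metis (mono_tags, lifting) DiffE image_eqI mem_Collect_eq)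
  qed
  show "equivariant_locally_constant ?h"
    unfolding equivariant_locally_constant_def
  proof (intro conjI ballI allI impI)
    fix \<sigma> assume \<sigma>: "\<sigma> \<in> arrows \<Sigma>"
    show "\<exists>U. openin (gtop \<Sigma>) U \<and> \<sigma> \<in> U \<and> (\<forall>\<tau>\<in>U. ?h \<tau> = ?h \<sigma>)"
    proof (cases "\<sigma> \<in> W")
      case True
      let ?p = "\<lambda>\<sigma>. gmult \<Sigma> (ginv \<Sigma> (P (b \<sigma>))) \<sigma>"
      have "?p \<sigma> \<in> arrows \<Sigma>"
        using cont True tsW by (auto simp: continuous_map_def arrows_def)
      then obtain U where U: "openin (gtop \<Sigma>) U" "?p \<sigma> \<in> U" "\<forall>\<tau>\<in>U. f \<tau> = f (?p \<sigma>)"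
        using equivariant_locally_constantD(2)[OF f'(1)] by blast
      have "openin (gtop \<Sigma>) {\<tau> \<in> W. ?p \<tau> \<in> U}"
        using openin_trans_full[OF openin_continuous_map_preimage[OF cont U(1)] oW] unfolding tsW .
      moreover have "?h \<tau> = ?h \<sigma>" if "\<tau> \<in> {\<tau> \<in> W. ?p \<tau> \<in> U}" for \<tau>
        using U(3)[rule_format, of "?p \<tau>"] that h[of \<tau>] h[OF True] by simp
      ultimately show ?thesis
        using True U(2) by (intro exI[of _ "{\<tau> \<in> W. ?p \<tau> \<in> U}"]) blast
    next
      case False
      then show ?thesis using \<sigma> oW' h0 by (intro exI[of _ "arrows \<Sigma> - W"]) auto
    qed
  next
    fix t :: 'r and \<sigma> assume t: "t \<in> ring_units" and \<sigma>: "\<sigma> \<in> arrows \<Sigma>"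
    note a = act_closed[OF \<sigma> t]
    show "?h (act t \<sigma>) = unit_inverse t * ?h \<sigma>"
    proof (cases "\<sigma> \<in> W")
      case True
      then have W: "act t \<sigma> \<in> W" "b (act t \<sigma>) = b \<sigma>" using a by (auto simp: W_def b_def)
      have c: "(ginv \<Sigma> (P (b \<sigma>)), \<sigma>) \<in> composable \<Sigma>"
        using b[OF True] P \<sigma> by (auto simp: composable_\<Sigma>_iff \<Sigma>.ginv_closed q_ginv G.src_ginv)
      show ?thesis
        using h[OF True] h[OF W(1)] W(2) act_gmult_right(2)[OF c t]
          equivariant_locally_constantD(3)[OF f'(1) t \<Sigma>.gmult_closed[OF c]] by simp
    next
      case False
      then have "act t \<sigma> \<in> arrows \<Sigma> - W" using a \<sigma> by (auto simp: W_def)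
      then show ?thesis using h0 False \<sigma> by simp
    qed
  qed (simp add: twisted_conv_def)
qed

end

context discrete_twist
begin

lemma compact_section_ex:
  assumes "openin (gtop G) U" "\<alpha> \<in> U"
  obtains B P where "compact_section B P" "open_bisection G B" "\<alpha> \<in> B" "B \<subseteq> U"
proof -
  have "\<alpha> \<in> arrows G" using assms openin_subset by (auto simp: arrows_def)
  then obtain B\<^sub>0 P where B\<^sub>0: "open_bisection G B\<^sub>0" "\<alpha> \<in> B\<^sub>0"
    "continuous_map (subtopology (gtop G) B\<^sub>0) (gtop \<Sigma>) P" "\<forall>\<beta>\<in>B\<^sub>0. q (P \<beta>) = \<beta>"
    using DT2 by metis
  have "openin (gtop G) (U \<inter> B\<^sub>0)" using assms(1) B\<^sub>0(1) by (auto simp: open_bisection_def)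
  then obtain B where B: "compactin (gtop G) B" "open_bisection G B" "\<alpha> \<in> B" "B \<subseteq> U \<inter> B\<^sub>0"
    using G.basis_compact_open_bisections[of "U \<inter> B\<^sub>0" \<alpha>] assms(2) B\<^sub>0(2) by blast
  have "continuous_map (subtopology (gtop G) B) (gtop \<Sigma>) P"
    using continuous_map_from_subtopology_mono[OF B\<^sub>0(3)] B(4) by blast
  then have "compact_section B P"
    using B B\<^sub>0(4) by (auto simp: compact_section_def open_bisection_def)
  with B that show thesis by blast
qed

lemma unit_compact_section:
  assumes "openin (gtop G) K" "compactin (gtop G) K" "K \<subseteq> unit_space G"
  shows "compact_section K (\<lambda>x. i (x, 1))"
proof -
  have "continuous_map (subtopology (unit_top G) K) (gtop \<Sigma>) (\<lambda>x. i (x, 1))"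
    by (intro continuous_map_from_subtopology continuous_i one_ring_units)
  then have "continuous_map (subtopology (gtop G) K) (gtop \<Sigma>) (\<lambda>x. i (x, 1))"
    using assms(3) by (simp add: unit_top_def subtopology_subtopology Int_absorb1)
  then show ?thesis
    using assms i_closed(2) one_ring_units by (auto simp: compact_section_def)
qed

text \<open>The only $\alpha$ for which $S(\alpha)^{-1}\sigma$ lies over a unit is $\alpha = q(\sigma)$, so the
  sum has a single term. It is an actual sum because a compact set meets each fibre of $r$ in a finite
  set; over an infinite index set the formal sum would be zero.\<close>

lemma conv_unit_section_fun:
  assumes K: "openin (gtop G) K" "compactin (gtop G) K" "K \<subseteq> unit_space G"
    and f: "f \<in> algebra"
  shows "twisted_conv G \<Sigma> q f (section_fun K (\<lambda>x. i (x, 1))) =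
    cut {\<alpha> \<in> arrows G. src G \<alpha> \<in> K} f"
proof
  fix \<sigma>
  let ?n = "section_fun K (\<lambda>x. i (x, 1))" and ?S = "inv_into (arrows \<Sigma>) q"
  let ?F = "\<lambda>\<alpha>. f (?S \<alpha>) * ?n (gmult \<Sigma> (ginv \<Sigma> (?S \<alpha>)) \<sigma>)"
  let ?I = "{\<alpha>. \<alpha> \<in> supp\<^sub>G \<Sigma> q f \<and> rng G \<alpha> = rng G (q \<sigma>)}"
  show "twisted_conv G \<Sigma> q f ?n \<sigma> = cut {\<alpha> \<in> arrows G. src G \<alpha> \<in> K} f \<sigma>"
  proof (cases "\<sigma> \<in> arrows \<Sigma>")
    case False
    then show ?thesis using algebra_outside[OF f] by (simp add: twisted_conv_def cut_def)
  next
    case \<sigma>: True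
    have q\<sigma>: "q \<sigma> \<in> arrows G" using \<sigma> by (rule q_closed)
    have fin: "finite ?I"
      using G.finite_compact_inter_fibre[OF algebraD(2)[OF f]] by simp
    have zero: "?F \<alpha> = 0" if \<alpha>: "\<alpha> \<in> ?I - {q \<sigma>}" for \<alpha>
    proof (rule ccontr)
      assume ne: "?F \<alpha> \<noteq> 0"
      have ar: "\<alpha> \<in> arrows G" using \<alpha> supp\<^sub>G_subset by blast
      note S = section_inv_into[OF ar]
      have c: "(ginv \<Sigma> (?S \<alpha>), \<sigma>) \<in> composable \<Sigma>"
        using S ar \<sigma> \<alpha> by (simp add: composable_\<Sigma>_iff \<Sigma>.ginv_closed q_ginv G.src_ginv)
      have "?n (gmult \<Sigma> (ginv \<Sigma> (?S \<alpha>)) \<sigma>) \<noteq> 0" using ne by auto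
      then have "q (gmult \<Sigma> (ginv \<Sigma> (?S \<alpha>)) \<sigma>) \<in> K" by (auto simp: section_fun_def split: if_splits)
      then have u: "gmult G (ginv G \<alpha>) (q \<sigma>) \<in> unit_space G"
        using K(3) q_gmult(2)[OF c] S by (auto simp: q_ginv)
      have c': "(ginv G \<alpha>, q \<sigma>) \<in> composable G" using q_gmult(1)[OF c] S by (simp add: q_ginv)
      have "gmult G (ginv G \<alpha>) (q \<sigma>) = src G \<alpha>"
        using u G.rng_gmult[OF c'] ar by (simp add: G.unit_space_iff G.rng_ginv)
      then have "q \<sigma> = gmult G \<alpha> (src G \<alpha>)"
        using G.cancel_left[OF c'] ar by (simp add: G.ginv_ginv)
      then show False using \<alpha> ar by (simp add: G.gmult_src_self)
    qed
    have "sum ?F ?I = sum ?F (?I \<inter> {q \<sigma>})"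
      using fin zero by (intro sum.mono_neutral_right) auto
    also have "\<dots> = cut {\<alpha> \<in> arrows G. src G \<alpha> \<in> K} f \<sigma>"
    proof (cases "q \<sigma> \<in> supp\<^sub>G \<Sigma> q f")
      case False
      then show ?thesis using mem_supp\<^sub>G_iff[OF algebraD(1)[OF f] \<sigma>] by (simp add: cut_def)
    next
      case True
      note S = section_inv_into[OF q\<sigma>]
      obtain t where t: "t \<in> ring_units" "\<sigma> = act t (?S (q \<sigma>))"
        using same_q_imp_act[OF \<sigma> S(1)] S(2) by metis
      have su: "src G (q \<sigma>) \<in> unit_space G" using q\<sigma> by (rule G.src_unit)
      have c: "(ginv \<Sigma> (?S (q \<sigma>)), ?S (q \<sigma>)) \<in> composable \<Sigma>"
        using \<Sigma>.composable_ginv_left[OF S(1)] .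
      have "gmult \<Sigma> (ginv \<Sigma> (?S (q \<sigma>))) (act t (?S (q \<sigma>))) = act t (src \<Sigma> (?S (q \<sigma>)))"
        using act_gmult_right(2)[OF c t(1)] by (simp add: src_def)
      also have "\<dots> = act t (i (src G (q \<sigma>), 1))" using S by (simp add: src_eq_i)
      finally have e: "gmult \<Sigma> (ginv \<Sigma> (?S (q \<sigma>))) \<sigma> = act t (i (src G (q \<sigma>), 1))"
        using t(2) by metis
      have i: "i (src G (q \<sigma>), 1) \<in> arrows \<Sigma>" "q (i (src G (q \<sigma>), 1)) = src G (q \<sigma>)"
        using i_closed[OF su one_ring_units] .
      have "?I \<inter> {q \<sigma>} = {q \<sigma>}" using True by blast
      then have "sum ?F (?I \<inter> {q \<sigma>}) = f (?S (q \<sigma>)) * ?n (act t (i (src G (q \<sigma>), 1)))"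
        using e by simp
      also have "\<dots> = cut {\<alpha> \<in> arrows G. src G \<alpha> \<in> K} f \<sigma>"
      proof (cases "src G (q \<sigma>) \<in> K")
        case True
        have "f \<sigma> = unit_inverse t * f (?S (q \<sigma>))"
          using algebra_act[OF f t(1) S(1)] t(2) by metis
        then show ?thesis
          using section_fun_act[OF unit_compact_section[OF K] True t(1)] True q\<sigma>
          by (simp add: cut_def mult.commute)
      next
        case False
        then show ?thesis using act_closed[OF i(1) t(1)] i(2) by (simp add: section_fun_def cut_def)
      qed
      finally show ?thesis .
    qed
    finally show ?thesis using \<sigma> by (simp add: twisted_conv_def Let_def)
  qed
qed

text \<open>Multiplying on both sides by the unit section function of $K$ restricts $f$ to the arrows that
  begin and end in $K$.\<close>

lemma compress:
  assumes K: "openin (gtop G) K" "compactin (gtop G) K" "K \<subseteq> unit_space G"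
    and bis: "open_bisection G K" and f: "f \<in> algebra"
  defines "e \<equiv> section_fun K (\<lambda>x. i (x, 1))"
  shows "e \<in> algebra" "twisted_conv G \<Sigma> q e f \<in> algebra"
    and "twisted_conv G \<Sigma> q (twisted_conv G \<Sigma> q e f) e \<in> algebra"
    and "supp\<^sub>G \<Sigma> q (twisted_conv G \<Sigma> q (twisted_conv G \<Sigma> q e f) e) =
      {\<delta> \<in> supp\<^sub>G \<Sigma> q f. rng G \<delta> \<in> K \<and> src G \<delta> \<in> K}"
proof -
  note sec = unit_compact_section[OF K]
  show e: "e \<in> algebra" unfolding e_def by (rule section_fun_in_algebra[OF sec])
  show g: "twisted_conv G \<Sigma> q e f \<in> algebra"
    unfolding e_def by (rule section_fun_conv_in_algebra[OF sec bis f])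
  have op: "openin (gtop G) {\<alpha> \<in> arrows G. src G \<alpha> \<in> K}"
    using openin_continuous_map_preimage[OF G.continuous_src K(1)] by (simp add: arrows_def)
  have cl: "closedin (gtop G) {\<alpha> \<in> arrows G. src G \<alpha> \<in> K}"
    using closedin_continuous_map_preimage[OF G.continuous_src compactin_imp_closedin[OF Hausdorff_G K(2)]]
    by (simp add: arrows_def)
  note eq = conv_unit_section_fun[OF K g, folded e_def]
  show "twisted_conv G \<Sigma> q (twisted_conv G \<Sigma> q e f) e \<in> algebra"
    unfolding eq by (rule cut_in_algebra[OF g op cl])
  have "supp\<^sub>G \<Sigma> q (twisted_conv G \<Sigma> q e f) = {\<delta> \<in> supp\<^sub>G \<Sigma> q f. rng G \<delta> \<in> K}"
  proof -
    have "(\<exists>\<beta>\<in>K. rng G \<beta> = rng G \<delta> \<and> gmult G (ginv G \<beta>) \<delta> \<in> supp\<^sub>G \<Sigma> q f) \<longleftrightarrow>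
        rng G \<delta> \<in> K \<and> \<delta> \<in> supp\<^sub>G \<Sigma> q f" if "\<delta> \<in> arrows G" for \<delta>
    proof -
      have "rng G \<beta> = \<beta>" "ginv G \<beta> = \<beta>" if "\<beta> \<in> K" for \<beta>
        using that K(3) by (auto simp: G.unit_space_iff G.ginv_of_unit)
      then show ?thesis using G.rng_gmult_self(2)[OF that] by auto
    qed
    then show ?thesis
      unfolding e_def supp\<^sub>G_section_fun_conv[OF sec G.inj_rng_bisection[OF bis] algebraD(1)[OF f]]
      using supp\<^sub>G_subset[of f] by blast
  qed
  then show "supp\<^sub>G \<Sigma> q (twisted_conv G \<Sigma> q (twisted_conv G \<Sigma> q e f) e) =
      {\<delta> \<in> supp\<^sub>G \<Sigma> q f. rng G \<delta> \<in> K \<and> src G \<delta> \<in> K}"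
    unfolding eq supp\<^sub>G_cut using supp\<^sub>G_subset[of f] by blast
qed

end

section \<open>Compression into the isotropy\<close>

context ample_groupoid
begin

text \<open>Cover $N$ by finitely many compact open bisections and shrink $U$ for one bisection $B$ at a
  time. The closed set $r(B \cap N)$ cannot contain a nonempty open set $V$: as $r$ is injective on
  $B$, the open set $B \cap r^{-1}(V)$ would be contained in $N$.\<close>

lemma rng_nowhere_dense:
  assumes H: "Hausdorff_space (gtop G)" and N: "compactin (gtop G) N"
    and meagre: "gtop G interior_of N = {}"
    and U: "openin (gtop G) U" "U \<subseteq> unit_space G" "U \<noteq> {}"
  shows "\<not> U \<subseteq> rng G ` N"
proof -
  obtain \<F> where \<F>: "finite \<F>" "N \<subseteq> \<Union>\<F>"
    "\<And>B. B \<in> \<F> \<Longrightarrow> open_bisection G B \<and> compactin (gtop G) B"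
    using finite_bisection_cover[OF N] by blast
  have clN: "closedin (gtop G) N" using compactin_imp_closedin[OF H N] .
  have "\<exists>V. openin (gtop G) V \<and> V \<noteq> {} \<and> V \<subseteq> U \<and> V \<inter> rng G ` (N \<inter> \<Union>\<F>') = {}"
    if "finite \<F>'" "\<F>' \<subseteq> \<F>" for \<F>'
    using that
  proof (induction \<F>')
    case empty
    then show ?case using U by (intro exI[of _ U]) auto
  next
    case (insert B \<F>')
    then obtain V where V: "openin (gtop G) V" "V \<noteq> {}" "V \<subseteq> U" "V \<inter> rng G ` (N \<inter> \<Union>\<F>') = {}"
      by auto
    have B: "open_bisection G B" "compactin (gtop G) B" using \<F>(3) insert.prems by auto
    have oB: "openin (gtop G) B" using B(1) by (simp add: open_bisection_def)
    have inj: "inj_on (rng G) B" using inj_rng_bisection[OF B(1)] .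
    have "compactin (gtop G) (B \<inter> N)" using compact_Int_closedin[OF B(2) clN] .
    then have "closedin (gtop G) (rng G ` (B \<inter> N))"
      using compactin_imp_closedin[OF H image_compactin[OF _ continuous_rng]] by blast
    then have "openin (gtop G) (V - rng G ` (B \<inter> N))" using V(1) by (simp add: openin_diff)
    moreover have "V - rng G ` (B \<inter> N) \<noteq> {}"
    proof
      assume "V - rng G ` (B \<inter> N) = {}"
      then have sub: "V \<subseteq> rng G ` (B \<inter> N)" by blast
      let ?W = "B \<inter> {\<alpha> \<in> topspace (gtop G). rng G \<alpha> \<in> V}"
      have "openin (gtop G) ?W"
        using oB openin_continuous_map_preimage[OF continuous_rng V(1)] by blast
      moreover have "?W \<subseteq> N"
      proof
        fix \<alpha> assume \<alpha>: "\<alpha> \<in> ?W"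
        then obtain \<beta> where "\<beta> \<in> B" "\<beta> \<in> N" "rng G \<alpha> = rng G \<beta>" using sub by blast
        then show "\<alpha> \<in> N" using inj_onD[OF inj, of \<alpha> \<beta>] \<alpha> by blast
      qed
      ultimately have "?W \<subseteq> gtop G interior_of N" by (simp add: interior_of_maximal)
      moreover have "?W \<noteq> {}"
      proof -
        obtain x where "x \<in> V" using V(2) by blast
        moreover then obtain \<beta> where "\<beta> \<in> B" "x = rng G \<beta>" using sub by blast
        ultimately show ?thesis using openin_subset[OF oB] by blast
      qed
      ultimately show False using meagre by blast
    qed
    ultimately show ?case
      using V(3,4) by (intro exI[of _ "V - rng G ` (B \<inter> N)"]) blast
  qed
  from this[OF \<F>(1) subset_refl] obtain V where
    "V \<noteq> {}" "V \<subseteq> U" "V \<inter> rng G ` (N \<inter> \<Union>\<F>) = {}" by blast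
  moreover from this(3) have "V \<inter> rng G ` N = {}" using \<F>(2) by blast
  ultimately show ?thesis by blast
qed

text \<open>The arrows of $D$ that could obstruct compression to a neighbourhood of a unit $y$ are those of
  $E = D \setminus \mathrm{Iso}(G)^\circ$. If none of them is an isotropy arrow at $y$, then $(y, y)$
  lies outside the compact set $(r, s)(E)$, hence so does $K \times K$ for a small neighbourhood $K$
  of $y$. The isotropy arrows in $E$ form a compact set with empty interior, whose range does
  not fill the open set $D \cap G^{(0)}$; this provides a suitable $y$, in general different from
  the given unit $x$.\<close>

lemma compress_to_Iso_interior:
  assumes H: "Hausdorff_space (gtop G)"
    and D: "compactin (gtop G) D" "openin (gtop G) D" and x: "x \<in> D" "x \<in> unit_space G"
  obtains K y where "open_bisection G K" "compactin (gtop G) K" "K \<subseteq> unit_space G"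
    "y \<in> K" "y \<in> D" "{\<delta> \<in> D. rng G \<delta> \<in> K \<and> src G \<delta> \<in> K} \<subseteq> Iso G"
proof -
  let ?J = "gtop G interior_of Iso G"
  let ?N = "(D - ?J) \<inter> Iso G"
  have "compactin (gtop G) (D \<inter> (topspace (gtop G) - ?J))"
    using compact_Int_closedin[OF D(1) closedin_diff[OF closedin_topspace openin_interior_of]] .
  moreover have "D \<inter> (topspace (gtop G) - ?J) = D - ?J" using openin_subset[OF D(2)] by blast
  ultimately have DJ: "compactin (gtop G) (D - ?J)" by simp
  have N: "compactin (gtop G) ?N" using compact_Int_closedin[OF DJ closed_Iso[OF H]] .
  have "gtop G interior_of ?N \<subseteq> ?J" by (rule interior_of_mono) blast
  moreover have "gtop G interior_of ?N \<subseteq> ?N" by (rule interior_of_subset)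
  ultimately have meagre: "gtop G interior_of ?N = {}" by blast
  have "\<not> D \<inter> unit_space G \<subseteq> rng G ` ?N"
    using x D(2) open_unit_space by (intro rng_nowhere_dense[OF H N meagre]) auto
  then obtain y where y: "y \<in> D" "y \<in> unit_space G" "y \<notin> rng G ` ?N" by blast
  let ?rs = "\<lambda>\<alpha>. (rng G \<alpha>, src G \<alpha>)"
  have "continuous_map (gtop G) (prod_topology (gtop G) (gtop G)) ?rs"
    by (intro continuous_map_pairedI continuous_rng continuous_src)
  from image_compactin[OF DJ this]
  have "closedin (prod_topology (gtop G) (gtop G)) (?rs ` (D - ?J))"
    using H by (intro compactin_imp_closedin) (simp_all add: Hausdorff_space_prod_topology)
  then have open_compl: "openin (prod_topology (gtop G) (gtop G))
      (topspace (prod_topology (gtop G) (gtop G)) - ?rs ` (D - ?J))" by blast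
  have "(y, y) \<in> topspace (prod_topology (gtop G) (gtop G)) - ?rs ` (D - ?J)"
  proof -
    have "y \<in> topspace (gtop G)" using y(1) openin_subset[OF D(2)] by blast
    moreover have "(y, y) \<notin> ?rs ` (D - ?J)"
    proof
      assume "(y, y) \<in> ?rs ` (D - ?J)"
      then obtain \<alpha> where \<alpha>: "\<alpha> \<in> D - ?J" "rng G \<alpha> = y" "src G \<alpha> = y" by auto
      then have "\<alpha> \<in> Iso G" using openin_subset[OF D(2)] by (auto simp: Iso_def arrows_def)
      then show False using \<alpha> y(3) by blast
    qed
    ultimately show ?thesis by simp
  qed
  from open_compl[unfolded openin_prod_topology_alt, rule_format, OF this]
  obtain U V where UV: "openin (gtop G) U" "openin (gtop G) V" "y \<in> U" "y \<in> V"
      "U \<times> V \<subseteq> topspace (prod_topology (gtop G) (gtop G)) - ?rs ` (D - ?J)" by metis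
  have "openin (gtop G) (U \<inter> V \<inter> unit_space G)" using UV open_unit_space by blast
  moreover have "y \<in> U \<inter> V \<inter> unit_space G" using UV y by blast
  ultimately obtain K where K: "compactin (gtop G) K" "open_bisection G K" "y \<in> K"
      "K \<subseteq> U \<inter> V \<inter> unit_space G"
    using basis_compact_open_bisections by blast
  have "{\<delta> \<in> D. rng G \<delta> \<in> K \<and> src G \<delta> \<in> K} \<subseteq> Iso G"
  proof
    fix \<delta> assume \<delta>: "\<delta> \<in> {\<delta> \<in> D. rng G \<delta> \<in> K \<and> src G \<delta> \<in> K}"
    then have "?rs \<delta> \<in> U \<times> V" using K(4) by blast
    from subsetD[OF UV(5) this] have "?rs \<delta> \<notin> ?rs ` (D - ?J)" by (elim DiffE)
    then have "\<delta> \<notin> D - ?J" by (rule contrapos_nn) (rule imageI)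
    then have "\<delta> \<in> ?J" using \<delta> by blast
    then show "\<delta> \<in> Iso G" by (rule subsetD[OF interior_of_subset])
  qed
  with K y(1) that[of K y] show thesis by blast
qed

end

section \<open>Homogeneous elements of the kernel\<close>

context graded_discrete_twist
begin

lemma c\<^sub>G_gmult: "(\<alpha>, \<beta>) \<in> composable G \<Longrightarrow> c\<^sub>G (gmult G \<alpha> \<beta>) = c\<^sub>G \<alpha> + c\<^sub>G \<beta>"
  using hom_c\<^sub>G by (auto simp: continuous_groupoid_hom_def group_groupoid_def)

lemma c\<^sub>G_unit:
  assumes "x \<in> unit_space G"
  shows "c\<^sub>G x = 0"
proof -
  have "x \<in> arrows G" "rng G x = x" using assms by (auto simp: G.unit_space_iff)
  then have "c\<^sub>G x + c\<^sub>G x = c\<^sub>G x + 0"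
    using c\<^sub>G_gmult[OF G.rng_gmult_self(1)] G.rng_gmult_self(2) by (metis add.right_neutral)
  then show ?thesis by (rule add_left_imp_eq)
qed

lemma c\<^sub>G_ginv:
  assumes "\<alpha> \<in> arrows G"
  shows "c\<^sub>G (ginv G \<alpha>) = - c\<^sub>G \<alpha>"
proof -
  have "c\<^sub>G \<alpha> + c\<^sub>G (ginv G \<alpha>) = 0"
    using c\<^sub>G_gmult[OF G.composable_ginv[OF assms]] c\<^sub>G_unit[OF G.rng_unit[OF assms]]
    by (simp add: rng_def)
  then show ?thesis by (rule minus_unique[symmetric])
qed

lemma continuous_c\<^sub>G: "continuous_map (gtop G) (discrete_topology UNIV) c\<^sub>G"
  using hom_c\<^sub>G by (simp add: continuous_groupoid_hom_def group_groupoid_def)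

lemma degree_fibre_clopen:
  "openin (gtop G) (degree_fibre G c\<^sub>G \<gamma>)" "closedin (gtop G) (degree_fibre G c\<^sub>G \<gamma>)"
  using openin_continuous_map_preimage[OF continuous_c\<^sub>G, of "{\<gamma>}"]
    closedin_continuous_map_preimage[OF continuous_c\<^sub>G, of "{\<gamma>}"]
  by (simp_all add: degree_fibre_def arrows_def)

lemma degree_fibre_\<Sigma>: "degree_fibre \<Sigma> c\<^sub>\<Sigma> \<gamma> = {\<sigma> \<in> arrows \<Sigma>. q \<sigma> \<in> degree_fibre G c\<^sub>G \<gamma>}"
  using c\<^sub>\<Sigma>_eq q_closed by (auto simp: degree_fibre_def)

text \<open>Multiply by the function of a section over a small bisection around $\alpha^{-1}$: it moves
  $\alpha$ to the unit $s(\alpha)$ and shifts the degree $\gamma$ to the identity.\<close>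

lemma translate_to_unit:
  assumes f: "f \<in> algebra" "supp\<^sub>G \<Sigma> q f \<subseteq> degree_fibre G c\<^sub>G \<gamma>" and \<alpha>: "\<alpha> \<in> supp\<^sub>G \<Sigma> q f"
  obtains n where "n \<in> algebra" "twisted_conv G \<Sigma> q n f \<in> algebra"
    "src G \<alpha> \<in> supp\<^sub>G \<Sigma> q (twisted_conv G \<Sigma> q n f)"
    "supp\<^sub>G \<Sigma> q (twisted_conv G \<Sigma> q n f) \<subseteq> degree_fibre G c\<^sub>G 0"
proof -
  have ar: "\<alpha> \<in> arrows G" using \<alpha> supp\<^sub>G_subset by blast
  have "c\<^sub>G \<alpha> = \<gamma>" using f(2) \<alpha> by (auto simp: degree_fibre_def)
  then have "ginv G \<alpha> \<in> degree_fibre G c\<^sub>G (- \<gamma>)"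
    using ar by (simp add: degree_fibre_def c\<^sub>G_ginv G.ginv_closed)
  then obtain B P where B: "compact_section B P" "open_bisection G B" "ginv G \<alpha> \<in> B"
      "B \<subseteq> degree_fibre G c\<^sub>G (- \<gamma>)"
    using compact_section_ex[OF degree_fibre_clopen(1)] by blast
  note supp = supp\<^sub>G_section_fun_conv[OF B(1) G.inj_rng_bisection[OF B(2)] algebraD(1)[OF f(1)]]
  show thesis
  proof (rule that)
    show "section_fun B P \<in> algebra" by (rule section_fun_in_algebra[OF B(1)])
    show "twisted_conv G \<Sigma> q (section_fun B P) f \<in> algebra"
      by (rule section_fun_conv_in_algebra[OF B(1,2) f(1)])
    show "src G \<alpha> \<in> supp\<^sub>G \<Sigma> q (twisted_conv G \<Sigma> q (section_fun B P) f)"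
      unfolding supp using B(3) \<alpha> ar
      by (auto intro!: bexI[of _ "ginv G \<alpha>"]
          simp: G.src_closed G.rng_ginv G.rng_src G.ginv_ginv G.gmult_src_self)
    show "supp\<^sub>G \<Sigma> q (twisted_conv G \<Sigma> q (section_fun B P) f) \<subseteq> degree_fibre G c\<^sub>G 0"
    proof
      fix \<delta> assume "\<delta> \<in> supp\<^sub>G \<Sigma> q (twisted_conv G \<Sigma> q (section_fun B P) f)"
      then obtain \<beta> where \<beta>: "\<delta> \<in> arrows G" "\<beta> \<in> B" "rng G \<beta> = rng G \<delta>"
          "gmult G (ginv G \<beta>) \<delta> \<in> supp\<^sub>G \<Sigma> q f" unfolding supp by blast
      have "\<beta> \<in> arrows G" "c\<^sub>G \<beta> = - \<gamma>" using \<beta>(2) B(4) by (auto simp: degree_fibre_def)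
      moreover from this have "(ginv G \<beta>, \<delta>) \<in> composable G"
        using \<beta> by (simp add: G.composable_iff G.ginv_closed G.src_ginv)
      moreover have "c\<^sub>G (gmult G (ginv G \<beta>) \<delta>) = \<gamma>" using \<beta>(4) f(2) by (auto simp: degree_fibre_def)
      ultimately have "\<gamma> + c\<^sub>G \<delta> = \<gamma> + 0" by (simp add: c\<^sub>G_gmult c\<^sub>G_ginv)
      then have "c\<^sub>G \<delta> = 0" by (rule add_left_imp_eq)
      then show "\<delta> \<in> degree_fibre G c\<^sub>G 0" using \<beta>(1) by (simp add: degree_fibre_def)
    qed
  qed
qed

lemma cut_degree_in_component:
  "f \<in> algebra \<Longrightarrow> cut (degree_fibre G c\<^sub>G \<gamma>) f \<in> steinberg_component G \<Sigma> i q c\<^sub>G \<gamma>"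
  by (simp add: steinberg_component_def cut_in_algebra degree_fibre_clopen supp\<^sub>G_cut)

lemma hom_add_conv:
  assumes "graded_ring_hom G \<Sigma> i q c\<^sub>G Q \<pi>" "f \<in> algebra" "g \<in> algebra"
  shows "\<pi> (\<lambda>\<sigma>. f \<sigma> + g \<sigma>) = \<pi> f + \<pi> g"
    and "\<pi> (twisted_conv G \<Sigma> q f g) = \<pi> f * \<pi> g"
  using assms by (simp_all add: graded_ring_hom_def)

lemma hom_zero:
  assumes "graded_ring_hom G \<Sigma> i q c\<^sub>G Q \<pi>"
  shows "\<pi> (\<lambda>_. 0) = 0"
  using hom_add_conv(1)[OF assms zero_in_algebra zero_in_algebra] by simp

text \<open>The images of the finitely many nonzero homogeneous parts of $f$ are homogeneous of different
  degrees and add up to $0$, so the directness of the sum in $Q$ makes each of them vanish.\<close>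

lemma kernel_homogeneous:
  assumes Q: "graded_ring Q" and \<pi>: "graded_ring_hom G \<Sigma> i q c\<^sub>G Q \<pi>"
    and f: "f \<in> algebra" "\<pi> f = 0"
  shows "\<pi> (cut (degree_fibre G c\<^sub>G \<gamma>) f) = 0"
proof -
  interpret graded_ring Q by fact
  let ?D = "supp\<^sub>G \<Sigma> q f" and ?f = "\<lambda>\<gamma>. cut (degree_fibre G c\<^sub>G \<gamma>) f"
  let ?U = "\<lambda>F. \<Union>\<gamma>\<in>F. degree_fibre G c\<^sub>G \<gamma>"
  have fin: "finite (c\<^sub>G ` ?D)"
    using image_compactin[OF algebraD(2)[OF f(1)] continuous_c\<^sub>G] by (simp add: compactin_discrete_topology)
  have inA: "cut (?U F) f \<in> algebra" if "finite F" for F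
    using that degree_fibre_clopen by (intro cut_in_algebra[OF f(1)] openin_Union closedin_Union) auto
  have sum: "\<pi> (cut (?U F) f) = (\<Sum>\<gamma>\<in>F. \<pi> (?f \<gamma>))" if "finite F" for F
    using that
  proof (induction F)
    case empty
    then show ?case using hom_zero[OF \<pi>] by (simp add: cut_def)
  next
    case (insert \<gamma> F)
    have "cut (?U (insert \<gamma> F)) f = (\<lambda>\<sigma>. ?f \<gamma> \<sigma> + cut (?U F) f \<sigma>)"
      using insert(2) by (auto simp: cut_def degree_fibre_def fun_eq_iff)
    then show ?case
      using insert hom_add_conv(1)[OF \<pi> cut_in_algebra[OF f(1) degree_fibre_clopen] inA[OF insert(1)]] by simp
  qed
  have "cut (?U (c\<^sub>G ` ?D)) f = f"
  proof
    fix \<sigma> show "cut (?U (c\<^sub>G ` ?D)) f \<sigma> = f \<sigma>"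
    proof (cases "f \<sigma> = 0")
      case False
      then have "\<sigma> \<in> arrows \<Sigma>" using algebra_outside[OF f(1)] by blast
      then have "q \<sigma> \<in> ?D" using False mem_supp\<^sub>G_iff[OF algebraD(1)[OF f(1)]] by blast
      then show ?thesis using supp\<^sub>G_subset by (auto simp: cut_def degree_fibre_def)
    qed (simp add: cut_def)
  qed
  then have total: "(\<Sum>\<gamma>\<in>c\<^sub>G ` ?D. \<pi> (?f \<gamma>)) = 0" using sum[OF fin] f(2) by simp
  have outside: "\<pi> (?f \<gamma>) = 0" if "\<gamma> \<notin> c\<^sub>G ` ?D" for \<gamma>
  proof -
    have "?f \<gamma> = (\<lambda>_. 0)"
    proof
      fix \<sigma> show "?f \<gamma> \<sigma> = 0"
      proof (cases "f \<sigma> = 0")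
        case False
        then have "\<sigma> \<in> arrows \<Sigma>" using algebra_outside[OF f(1)] by blast
        then have "q \<sigma> \<in> ?D" using False mem_supp\<^sub>G_iff[OF algebraD(1)[OF f(1)]] by blast
        then show ?thesis using that by (auto simp: cut_def degree_fibre_def)
      qed (simp add: cut_def)
    qed
    then show ?thesis using hom_zero[OF \<pi>] by simp
  qed
  let ?h = "\<lambda>\<gamma>. \<pi> (?f \<gamma>)"
  let ?P = "\<lambda>h. (\<forall>\<gamma>. h \<gamma> \<in> Q \<gamma>) \<and> finite {\<gamma>. h \<gamma> \<noteq> 0} \<and> 0 = (\<Sum>\<gamma> | h \<gamma> \<noteq> 0. h \<gamma>)"
  have "?P ?h"
  proof (intro conjI allI)
    show "?h \<gamma> \<in> Q \<gamma>" for \<gamma>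
      using \<pi> cut_degree_in_component[OF f(1)] unfolding graded_ring_hom_def by blast
    have sub: "{\<gamma>. ?h \<gamma> \<noteq> 0} \<subseteq> c\<^sub>G ` ?D" using outside by blast
    then show "finite {\<gamma>. ?h \<gamma> \<noteq> 0}" using fin by (rule finite_subset)
    have "(\<Sum>\<gamma>\<in>c\<^sub>G ` ?D. ?h \<gamma>) = (\<Sum>\<gamma> | ?h \<gamma> \<noteq> 0. ?h \<gamma>)"
      by (rule sum.mono_neutral_right[OF fin sub]) simp
    then show "0 = (\<Sum>\<gamma> | ?h \<gamma> \<noteq> 0. ?h \<gamma>)" using total by simp
  qed
  moreover have "?P (\<lambda>_. 0)" using component_subgroup(1) by simp
  moreover have "\<exists>\<^sub>\<le>\<^sub>1h. ?P h" using direct_sum[of 0] by (simp only: ex1_iff_ex_Uniq)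
  ultimately have "?h = (\<lambda>_. 0)" by (intro Uniq_D[of ?P])
  then show ?thesis by (rule fun_cong)
qed

text \<open>Pass to a homogeneous part of $f$, translate it so that its support contains a unit and has
  degree the identity, and compress. All these operations stay in the kernel, and
  the compression still has the unit $y$ in its support.\<close>

lemma kernel_meets_Iso:
  assumes Q: "graded_ring Q" and \<pi>: "graded_ring_hom G \<Sigma> i q c\<^sub>G Q \<pi>"
    and f: "f \<in> algebra" "\<pi> f = 0" "f \<noteq> (\<lambda>_. 0)"
  obtains h where "h \<in> algebra" "\<pi> h = 0" "h \<noteq> (\<lambda>_. 0)"
    "supp\<^sub>G \<Sigma> q h \<subseteq> Iso G \<inter> degree_fibre G c\<^sub>G 0"
proof -
  note mult = hom_add_conv(2)[OF \<pi>]
  obtain \<sigma> where \<sigma>: "f \<sigma> \<noteq> 0" using f(3) by blast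
  then have ar: "\<sigma> \<in> arrows \<Sigma>" using algebra_outside[OF f(1)] by blast
  define f' where "f' = cut (degree_fibre G c\<^sub>G (c\<^sub>G (q \<sigma>))) f"
  have f': "f' \<in> algebra" "\<pi> f' = 0" "supp\<^sub>G \<Sigma> q f' \<subseteq> degree_fibre G c\<^sub>G (c\<^sub>G (q \<sigma>))"
    using cut_in_algebra[OF f(1) degree_fibre_clopen] kernel_homogeneous[OF Q \<pi> f(1,2)]
    by (auto simp: f'_def supp\<^sub>G_cut)
  have "f' \<sigma> \<noteq> 0" using \<sigma> q_closed[OF ar] by (simp add: f'_def cut_def degree_fibre_def)
  then have \<alpha>: "q \<sigma> \<in> supp\<^sub>G \<Sigma> q f'" using mem_supp\<^sub>G_iff[OF algebraD(1)[OF f'(1)] ar] by blast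
  obtain n where n: "n \<in> algebra" "twisted_conv G \<Sigma> q n f' \<in> algebra"
    "src G (q \<sigma>) \<in> supp\<^sub>G \<Sigma> q (twisted_conv G \<Sigma> q n f')"
    "supp\<^sub>G \<Sigma> q (twisted_conv G \<Sigma> q n f') \<subseteq> degree_fibre G c\<^sub>G 0"
    using translate_to_unit[OF f'(1,3) \<alpha>] by blast
  define g where "g = twisted_conv G \<Sigma> q n f'"
  note n = n[folded g_def]
  have \<pi>g: "\<pi> g = 0" using mult[OF n(1) f'(1)] f'(2) by (simp add: g_def)
  obtain K y where K: "open_bisection G K" "compactin (gtop G) K" "K \<subseteq> unit_space G"
    "y \<in> K" "y \<in> supp\<^sub>G \<Sigma> q g" "{\<delta> \<in> supp\<^sub>G \<Sigma> q g. rng G \<delta> \<in> K \<and> src G \<delta> \<in> K} \<subseteq> Iso G"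
    using G.compress_to_Iso_interior[OF Hausdorff_G algebraD(2)[OF n(2)]
        supp\<^sub>G_clopen(1)[OF algebraD(1)[OF n(2)]] n(3) src_q_unit[OF ar]] by blast
  have oK: "openin (gtop G) K" using K(1) by (simp add: open_bisection_def)
  define e where "e = section_fun K (\<lambda>x. i (x, 1))"
  note c = compress[OF oK K(2,3,1) n(2), folded e_def]
  let ?h = "twisted_conv G \<Sigma> q (twisted_conv G \<Sigma> q e g) e"
  show thesis
  proof (rule that)
    show "?h \<in> algebra" by (rule c(3))
    show "\<pi> ?h = 0" using mult[OF c(2,1)] mult[OF c(1) n(2)] \<pi>g by simp
    show "supp\<^sub>G \<Sigma> q ?h \<subseteq> Iso G \<inter> degree_fibre G c\<^sub>G 0" using c(4) K(6) n(4) by blast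
    have "y \<in> supp\<^sub>G \<Sigma> q ?h"
      using K(3,4,5) G.unit_space_iff[of y] G.src_of_unit[of y] unfolding c(4) by auto
    then show "?h \<noteq> (\<lambda>_. 0)" by (auto simp: supp\<^sub>G_def supp_def)
  qed
qed

end

section \<open>The isotropy subalgebra\<close>

lemma (in topological_groupoid) gtop_Iso_interior_restrict:
  assumes "openin (gtop G) H"
  shows "gtop (Iso_interior (restrict_groupoid G H)) =
    subtopology (gtop G) (gtop G interior_of (Iso G \<inter> H))"
proof -
  have "Iso (restrict_groupoid G H) = Iso G \<inter> H"
    by (auto simp: Iso_def restrict_groupoid_def arrows_def rng_def src_def)
  moreover have "subtopology (gtop G) H interior_of (Iso G \<inter> H) = gtop G interior_of (Iso G \<inter> H)"
    using interior_of_subtopology_open[OF assms, of "Iso G \<inter> H"]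
      interior_of_subset[of "gtop G" "Iso G \<inter> H"] by blast
  moreover have "H \<inter> gtop G interior_of (Iso G \<inter> H) = gtop G interior_of (Iso G \<inter> H)"
    using interior_of_subset[of "gtop G" "Iso G \<inter> H"] by blast
  ultimately show ?thesis
    by (simp add: Iso_interior_def restrict_groupoid_def subtopology_subtopology)
qed

text \<open>Extension by zero identifies the algebra of the interior of the isotropy with the functions
  supported in the isotropy of degree the identity. No interior appears on the right because
  $\mathrm{supp}_G(f)$ is open. Conversely, the extension by zero is locally constant on all of
  $\Sigma$ because the support of a function on the smaller twist is still the full preimage of a
  compact, hence closed, subset of $G$.\<close>

lemma (in graded_discrete_twist) twisted_steinberg_Iso_interior:
  "twisted_steinberg (Iso_interior (identity_component G c\<^sub>G))
      (Iso_interior (identity_component \<Sigma> c\<^sub>\<Sigma>)) i q =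
    {f \<in> algebra. supp\<^sub>G \<Sigma> q f \<subseteq> Iso G \<inter> degree_fibre G c\<^sub>G 0}" (is "twisted_steinberg ?G ?\<Sigma> i q = _")
proof -
  define J where "J = gtop G interior_of (Iso G \<inter> degree_fibre G c\<^sub>G 0)"
  define J\<^sub>\<Sigma> where "J\<^sub>\<Sigma> = gtop \<Sigma> interior_of (Iso \<Sigma> \<inter> degree_fibre \<Sigma> c\<^sub>\<Sigma> 0)"
  have oF: "openin (gtop \<Sigma>) (degree_fibre \<Sigma> c\<^sub>\<Sigma> 0)"
    unfolding degree_fibre_\<Sigma> by (rule open_q_vimage[OF degree_fibre_clopen(1)])
  have topG: "gtop ?G = subtopology (gtop G) J"
    unfolding identity_component_def J_def
    by (rule G.gtop_Iso_interior_restrict[OF degree_fibre_clopen(1)])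
  have top\<Sigma>: "gtop ?\<Sigma> = subtopology (gtop \<Sigma>) J\<^sub>\<Sigma>"
    unfolding identity_component_def J\<^sub>\<Sigma>_def by (rule \<Sigma>.gtop_Iso_interior_restrict[OF oF])
  have oJ: "openin (gtop \<Sigma>) J\<^sub>\<Sigma>" by (simp add: J\<^sub>\<Sigma>_def)
  have J\<Sigma>: "J\<^sub>\<Sigma> \<subseteq> arrows \<Sigma>" using openin_subset[OF oJ] by (simp add: arrows_def)
  have arr: "arrows ?\<Sigma> = J\<^sub>\<Sigma>" using J\<Sigma> by (auto simp: arrows_def top\<Sigma>)
  have act: "twist_act ?\<Sigma> i q = act"
    by (simp add: twist_act_def[abs_def] Iso_interior_def identity_component_def restrict_groupoid_def
        rng_def)
  have op: "openin (gtop ?\<Sigma>) U \<longleftrightarrow> openin (gtop \<Sigma>) U \<and> U \<subseteq> J\<^sub>\<Sigma>" for U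
    unfolding top\<Sigma> by (rule openin_open_subtopology[OF oJ])
  have iso: "\<sigma> \<in> Iso \<Sigma> \<inter> degree_fibre \<Sigma> c\<^sub>\<Sigma> 0 \<longleftrightarrow> q \<sigma> \<in> Iso G \<inter> degree_fibre G c\<^sub>G 0"
    if "\<sigma> \<in> arrows \<Sigma>" for \<sigma>
  proof -
    have "rng \<Sigma> \<sigma> = src \<Sigma> \<sigma> \<longleftrightarrow> rng G (q \<sigma>) = src G (q \<sigma>)"
      using inj_on_eq_iff[OF inj_q_units \<Sigma>.rng_unit \<Sigma>.src_unit] that q_rng q_src by metis
    then show ?thesis using that q_closed by (auto simp: Iso_def degree_fibre_\<Sigma>)
  qed
  show ?thesis
  proof (intro equalityI subsetI)
    fix f assume f: "f \<in> twisted_steinberg ?G ?\<Sigma> i q"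
    have zero: "f \<sigma> = 0" if "\<sigma> \<notin> J\<^sub>\<Sigma>" for \<sigma>
      using f that by (simp add: twisted_steinberg_def arr)
    have supp: "supp ?\<Sigma> f = supp \<Sigma> f" using zero J\<Sigma> by (auto simp: supp_def arr)
    then have comp: "compactin (gtop G) (supp\<^sub>G \<Sigma> q f)"
      using f by (simp add: twisted_steinberg_def topG supp\<^sub>G_def compactin_subtopology)
    have con: "f (act t \<sigma>) = unit_inverse t * f \<sigma>" if "t \<in> ring_units" "\<sigma> \<in> J\<^sub>\<Sigma>" for t \<sigma>
      using f that by (simp add: twisted_steinberg_def arr act)
    have nz: "f (act t \<sigma>) \<noteq> 0" if "t \<in> ring_units" "f \<sigma> \<noteq> 0" for t \<sigma>
      using con[OF that(1)] zero that unit_mult_eq_0_iff[OF unit_inverse_units[OF that(1)]] by metis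
    have supp_iff: "q \<sigma> \<in> supp\<^sub>G \<Sigma> q f \<longleftrightarrow> f \<sigma> \<noteq> 0" if \<sigma>: "\<sigma> \<in> arrows \<Sigma>" for \<sigma>
    proof
      assume "q \<sigma> \<in> supp\<^sub>G \<Sigma> q f"
      then obtain \<tau> where "\<tau> \<in> arrows \<Sigma>" "f \<tau> \<noteq> 0" "q \<sigma> = q \<tau>"
        by (auto simp: supp\<^sub>G_def supp_def)
      then show "f \<sigma> \<noteq> 0" using same_q_imp_act[OF \<sigma>] nz by metis
    next
      assume "f \<sigma> \<noteq> 0"
      then show "q \<sigma> \<in> supp\<^sub>G \<Sigma> q f" using \<sigma> unfolding supp\<^sub>G_def supp_def by blast
    qed
    have "equivariant_locally_constant f"
      unfolding equivariant_locally_constant_def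
    proof (intro conjI ballI allI impI)
      fix \<sigma> assume \<sigma>: "\<sigma> \<in> arrows \<Sigma>"
      show "\<exists>U. openin (gtop \<Sigma>) U \<and> \<sigma> \<in> U \<and> (\<forall>\<tau>\<in>U. f \<tau> = f \<sigma>)"
      proof (cases "f \<sigma> = 0")
        case False
        then have "\<sigma> \<in> arrows ?\<Sigma>" using zero arr by blast
        then obtain U where "openin (gtop ?\<Sigma>) U" "\<sigma> \<in> U" "\<forall>\<tau>\<in>U. f \<tau> = f \<sigma>"
          using f unfolding twisted_steinberg_def by blast
        then show ?thesis using op by blast
      next
        case True
        let ?U = "{\<tau> \<in> arrows \<Sigma>. q \<tau> \<in> topspace (gtop G) - supp\<^sub>G \<Sigma> q f}"
        have "openin (gtop G) (topspace (gtop G) - supp\<^sub>G \<Sigma> q f)"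
          using compactin_imp_closedin[OF Hausdorff_G comp] by blast
        from open_q_vimage[OF this] have "openin (gtop \<Sigma>) ?U" .
        moreover have "\<sigma> \<in> ?U" using \<sigma> True supp_iff q_closed by (simp add: arrows_def)
        moreover have "f \<tau> = f \<sigma>" if "\<tau> \<in> ?U" for \<tau> using that True supp_iff by auto
        ultimately show ?thesis by blast
      qed
    next
      fix t :: 'r and \<sigma> assume t: "t \<in> ring_units" and \<sigma>: "\<sigma> \<in> arrows \<Sigma>"
      show "f (act t \<sigma>) = unit_inverse t * f \<sigma>"
      proof (cases "\<sigma> \<in> J\<^sub>\<Sigma>")
        case False
        then have "f \<sigma> = 0" by (rule zero)
        moreover have "f (act t \<sigma>) = 0"
          using supp_iff[OF \<sigma>] supp_iff[OF act_closed(1)[OF \<sigma> t]] act_closed(2)[OF \<sigma> t] \<open>f \<sigma> = 0\<close>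
          by metis
        ultimately show ?thesis by simp
      qed (rule con[OF t])
    qed (use zero J\<Sigma> in blast)
    moreover have "supp\<^sub>G \<Sigma> q f \<subseteq> Iso G \<inter> degree_fibre G c\<^sub>G 0"
    proof
      fix \<alpha> assume "\<alpha> \<in> supp\<^sub>G \<Sigma> q f"
      then obtain \<sigma> where \<sigma>: "\<sigma> \<in> arrows \<Sigma>" "f \<sigma> \<noteq> 0" "\<alpha> = q \<sigma>"
        by (auto simp: supp\<^sub>G_def supp_def)
      then have "\<sigma> \<in> J\<^sub>\<Sigma>" using zero by blast
      then have "\<sigma> \<in> Iso \<Sigma> \<inter> degree_fibre \<Sigma> c\<^sub>\<Sigma> 0" unfolding J\<^sub>\<Sigma>_def by (rule subsetD[OF interior_of_subset])
      then show "\<alpha> \<in> Iso G \<inter> degree_fibre G c\<^sub>G 0" using iso \<sigma> by blast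
    qed
    ultimately show "f \<in> {f \<in> algebra. supp\<^sub>G \<Sigma> q f \<subseteq> Iso G \<inter> degree_fibre G c\<^sub>G 0}"
      using comp by (simp add: algebra_iff)
  next
    fix f assume "f \<in> {f \<in> algebra. supp\<^sub>G \<Sigma> q f \<subseteq> Iso G \<inter> degree_fibre G c\<^sub>G 0}"
    then have f: "f \<in> algebra" "supp\<^sub>G \<Sigma> q f \<subseteq> Iso G \<inter> degree_fibre G c\<^sub>G 0" by auto
    note supp_open = supp\<^sub>G_clopen(1)[OF algebraD(1)[OF f(1)]]
    have suppJ: "supp\<^sub>G \<Sigma> q f \<subseteq> J" unfolding J_def by (rule interior_of_maximal[OF f(2) supp_open])
    have "{\<sigma> \<in> arrows \<Sigma>. q \<sigma> \<in> supp\<^sub>G \<Sigma> q f} \<subseteq> J\<^sub>\<Sigma>"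
      unfolding J\<^sub>\<Sigma>_def
      by (rule interior_of_maximal[OF _ open_q_vimage[OF supp_open]]) (use iso f(2) in blast)
    then have zero: "f \<sigma> = 0" if "\<sigma> \<notin> J\<^sub>\<Sigma>" for \<sigma>
      using that mem_supp\<^sub>G_iff[OF algebraD(1)[OF f(1)]] algebra_outside[OF f(1)] by blast
    have supp: "supp ?\<Sigma> f = supp \<Sigma> f" using zero J\<Sigma> by (auto simp: supp_def arr)
    show "f \<in> twisted_steinberg ?G ?\<Sigma> i q"
      unfolding twisted_steinberg_def mem_Collect_eq arr act
    proof (intro conjI ballI allI impI)
      show "compactin (gtop ?G) (supp\<^sub>G ?\<Sigma> q f)"
        using algebraD(2)[OF f(1)] suppJ
        by (simp add: topG compactin_subtopology supp supp\<^sub>G_def)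
    next
      fix \<sigma> assume \<sigma>: "\<sigma> \<in> J\<^sub>\<Sigma>"
      obtain U where "openin (gtop \<Sigma>) U" "\<sigma> \<in> U" "\<forall>\<tau>\<in>U. f \<tau> = f \<sigma>"
        using algebra_locally_constant[OF f(1)] \<sigma> J\<Sigma> by blast
      then show "\<exists>U. openin (gtop ?\<Sigma>) U \<and> \<sigma> \<in> U \<and> (\<forall>\<tau>\<in>U. f \<tau> = f \<sigma>)"
        unfolding op using \<sigma> oJ by (intro exI[of _ "U \<inter> J\<^sub>\<Sigma>"]) blast
    qed (use zero algebra_act[OF f(1)] J\<Sigma> in blast)+
  qed
qed

section \<open>The graded uniqueness theorem\<close>

theorem theorem4p3:
  fixes G :: "'a tgroupoid" and \<Sigma> :: "'b tgroupoid"
    and i :: "'a \<times> 'r::{comm_ring, monoid_mult} \<Rightarrow> 'b" and q :: "'b \<Rightarrow> 'a"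
    and c\<^sub>\<Sigma> :: "'b \<Rightarrow> 'g::group_add" and c\<^sub>G :: "'a \<Rightarrow> 'g"
    and Q :: "'g \<Rightarrow> 'q::ring set" and \<pi> :: "('b \<Rightarrow> 'r) \<Rightarrow> 'q"
  defines "G\<^sub>\<epsilon> \<equiv> identity_component G c\<^sub>G"
    and "\<Sigma>\<^sub>\<epsilon> \<equiv> identity_component \<Sigma> c\<^sub>\<Sigma>"
  defines "\<iota>\<^sub>\<epsilon> \<equiv> extend_by_zero \<Sigma>\<^sub>\<epsilon>"
    and "\<iota> \<equiv> extend_by_zero (Iso_interior \<Sigma>\<^sub>\<epsilon>)"
  assumes "ample_groupoid G" and "Hausdorff_space (gtop G)"
    and "graded_discrete_twist G \<Sigma> i q c\<^sub>\<Sigma> c\<^sub>G"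
    and "graded_ring Q"
    and "graded_ring_hom G \<Sigma> i q c\<^sub>G Q \<pi>"
  shows "inj_on \<pi> (twisted_steinberg G \<Sigma> i q) \<longleftrightarrow>
    (\<forall>f \<in> twisted_steinberg (Iso_interior G\<^sub>\<epsilon>) (Iso_interior \<Sigma>\<^sub>\<epsilon>) i q.
       f \<noteq> (\<lambda>_. 0) \<longrightarrow> \<pi> (\<iota>\<^sub>\<epsilon> (\<iota> f)) \<noteq> 0)"
proof -
  interpret graded_discrete_twist G \<Sigma> i q c\<^sub>\<Sigma> c\<^sub>G by fact
  note Q = \<open>graded_ring Q\<close> and \<pi> = \<open>graded_ring_hom G \<Sigma> i q c\<^sub>G Q \<pi>\<close>
  let ?A = "twisted_steinberg (Iso_interior G\<^sub>\<epsilon>) (Iso_interior \<Sigma>\<^sub>\<epsilon>) i q"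
  have A: "?A = {f \<in> algebra. supp\<^sub>G \<Sigma> q f \<subseteq> Iso G \<inter> degree_fibre G c\<^sub>G 0}"
    unfolding G\<^sub>\<epsilon>_def \<Sigma>\<^sub>\<epsilon>_def by (rule twisted_steinberg_Iso_interior)
  have \<iota>: "\<iota>\<^sub>\<epsilon> (\<iota> f) = f" if "f \<in> ?A" for f
  proof -
    have "f \<sigma> = 0" if "\<sigma> \<notin> arrows (Iso_interior \<Sigma>\<^sub>\<epsilon>)" for \<sigma>
      using \<open>f \<in> ?A\<close> that by (simp add: twisted_steinberg_def)
    moreover have "arrows (Iso_interior \<Sigma>\<^sub>\<epsilon>) \<subseteq> arrows \<Sigma>\<^sub>\<epsilon>"
      by (auto simp: Iso_interior_def restrict_groupoid_def arrows_def)
    ultimately show ?thesis by (auto simp: \<iota>\<^sub>\<epsilon>_def \<iota>_def extend_by_zero_def fun_eq_iff)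
  qed
  show ?thesis
  proof
    assume inj: "inj_on \<pi> algebra"
    show "\<forall>f\<in>?A. f \<noteq> (\<lambda>_. 0) \<longrightarrow> \<pi> (\<iota>\<^sub>\<epsilon> (\<iota> f)) \<noteq> 0"
    proof (intro ballI impI notI)
      fix f assume f: "f \<in> ?A" "f \<noteq> (\<lambda>_. 0)" "\<pi> (\<iota>\<^sub>\<epsilon> (\<iota> f)) = 0"
      then have "\<pi> f = \<pi> (\<lambda>_. 0)" using \<iota> hom_zero[OF \<pi>] by simp
      moreover have "f \<in> algebra" using f(1) A by blast
      ultimately show False using inj_onD[OF inj] zero_in_algebra f(2) by blast
    qed
  next
    assume nz: "\<forall>f\<in>?A. f \<noteq> (\<lambda>_. 0) \<longrightarrow> \<pi> (\<iota>\<^sub>\<epsilon> (\<iota> f)) \<noteq> 0"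
    show "inj_on \<pi> algebra"
    proof (rule inj_onI, rule ccontr)
      fix f g assume fg: "f \<in> algebra" "g \<in> algebra" "\<pi> f = \<pi> g" "f \<noteq> g"
      let ?d = "\<lambda>\<sigma>. f \<sigma> - g \<sigma>"
      have d: "?d \<in> algebra" using diff_in_algebra fg by blast
      have "\<pi> ?d = 0" using hom_add_conv(1)[OF \<pi> d fg(2)] fg(3) by simp
      moreover have "?d \<noteq> (\<lambda>_. 0)" using fg(4) by (auto simp: fun_eq_iff)
      ultimately obtain h where h: "h \<in> algebra" "\<pi> h = 0" "h \<noteq> (\<lambda>_. 0)"
          "supp\<^sub>G \<Sigma> q h \<subseteq> Iso G \<inter> degree_fibre G c\<^sub>G 0"
        using kernel_meets_Iso[OF Q \<pi> d] by blast
      then have "h \<in> ?A" using A by blast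
      then show False using nz \<iota> h(2,3) by metis
    qed
  qed
qed

end
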